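(* Let $\{|a_i\rangle\}$, $\{|b_j\rangle\}$ be orthonormal bases of finite-dimensional systems $A$, $B$, $n=\min\{\dim A,\dim B\}$, and let $\rho_{AB}=\sum_{i,j=1}^n\rho_{ij}|a_i\rangle\langle a_j|\otimes|b_i\rangle\langle b_j|$ be a state (a maximally correlated state). Let $E$ be an entanglement measure. Then $$Q^{AB}_E(\rho_{AB})=Q^A_E(\rho_{AB})=E_{A:B}(\rho_{AB}).$$
   Context: An entanglement measure $E$ assigns to each bipartite state $\tau_{X:Y}$ (of finite-dimensional systems, for any bipartition) a value $E_{X:Y}(\tau)$ that is nonnegative, zero on separable states, and does not increase under local operations and classical communication (in particular it is invariant under local unitaries/isometries). For a system $S$ of dimension $m$ with orthonormal basis $\{|s_k\rangle\}$, the measurement interaction is the isometry $V_S:S\to S\otimes S'$ ($S'$ $m$-dimensional with computational basis $\{|k\rangle\}$), $V_S|s_k\rangle=|s_k\rangle|k\rangle$. Define $Q^A_E(\rho_{AB})=\min E_{AB:A'}\big((V_A\otimes\mathbb I_B)\rho_{AB}(V_A\otimes\mathbb I_B)^\dagger\big)$ over orthonormal bases of $A$, and $Q^{AB}_E(\rho_{AB})=\min E_{AB:A'B'}\big((V_A\otimes V_B)\rho_{AB}(V_A\otimes V_B)^\dagger\big)$ over orthonormal bases of $A$ and $B$. *)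

theory Defs
  imports Complex_Main "Jordan_Normal_Form.Matrix"
begin

text \<open>Operators are complex matrices (Jordan_Normal_Form). Vectors of C^d are indexed 0..d-1.
  A composite system X (x) Y with dims dX, dY uses the index x*dY + y.\<close>

definition adj :: "complex mat \<Rightarrow> complex mat" where
  "adj A = mat (dim_col A) (dim_row A) (\<lambda>(i,j). cnj (A $$ (j,i)))"

definition kron :: "complex mat \<Rightarrow> complex mat \<Rightarrow> complex mat" where
  "kron A B = mat (dim_row A * dim_row B) (dim_col A * dim_col B)
     (\<lambda>(i,j). A $$ (i div dim_row B, j div dim_col B) * B $$ (i mod dim_row B, j mod dim_col B))"

definition psd :: "nat \<Rightarrow> complex mat \<Rightarrow> bool" where
  "psd d M \<longleftrightarrow> M \<in> carrier_mat d d \<and> adj M = M \<and>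
     (\<forall>v. dim_vec v = d \<longrightarrow>
        Im ((\<Sum>i<d. cnj (v $ i) * (M *\<^sub>v v) $ i)) = 0 \<and>
        0 \<le> Re ((\<Sum>i<d. cnj (v $ i) * (M *\<^sub>v v) $ i)))"

definition is_state :: "nat \<Rightarrow> complex mat \<Rightarrow> bool" where
  "is_state d \<rho> \<longleftrightarrow> psd d \<rho> \<and> (\<Sum>i<d. \<rho> $$ (i,i)) = 1"

definition onb :: "nat \<Rightarrow> (nat \<Rightarrow> complex vec) \<Rightarrow> bool" where
  "onb d s \<longleftrightarrow> (\<forall>k<d. dim_vec (s k) = d) \<and>
     (\<forall>k<d. \<forall>l<d. (\<Sum>i<d. cnj (s k $ i) * s l $ i) = (if k = l then 1 else 0))"

definition separable :: "nat \<Rightarrow> nat \<Rightarrow> complex mat \<Rightarrow> bool" where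
  "separable dX dY \<rho> \<longleftrightarrow>
     (\<exists>(ps :: (real \<times> complex mat \<times> complex mat) list).
        (\<forall>(p,\<sigma>,\<tau>) \<in> set ps. 0 \<le> p \<and> is_state dX \<sigma> \<and> is_state dY \<tau>) \<and>
        (\<Sum>(p,_,_) \<leftarrow> ps. p) = 1 \<and>
        \<rho> = foldr (\<lambda>(p,\<sigma>,\<tau>) acc. complex_of_real p \<cdot>\<^sub>m kron \<sigma> \<tau> + acc) ps (0\<^sub>m (dX*dY) (dX*dY)))"

definition kraus_sum :: "nat \<Rightarrow> complex mat list \<Rightarrow> complex mat" where
  "kraus_sum d Ks = foldr (\<lambda>K acc. adj K * K + acc) Ks (0\<^sub>m d d)"

definition apply_kraus :: "nat \<Rightarrow> complex mat list \<Rightarrow> complex mat \<Rightarrow> complex mat" where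
  "apply_kraus d' Ks \<rho> = foldr (\<lambda>K acc. K * \<rho> * adj K + acc) Ks (0\<^sub>m d' d')"

text \<open>Finite-round LOCC instruments between X and Y.
  locc_instr dX dY dX' dY' ops: ops is a list of outcomes, each outcome a list of Kraus
  operators (dX'*dY') x (dX*dY). Generated by local instruments on X or on Y (trace
  preserving in total) and by classically conditioned composition: after outcome k,
  an arbitrary LOCC instrument (depending on k) is applied.\<close>
inductive locc_instr :: "nat \<Rightarrow> nat \<Rightarrow> nat \<Rightarrow> nat \<Rightarrow> complex mat list list \<Rightarrow> bool" where
  localX: "\<lbrakk> \<forall>K \<in> set (concat ops). K \<in> carrier_mat dX' dX;
             kraus_sum dX (concat ops) = 1\<^sub>m dX \<rbrakk> \<Longrightarrow>
           locc_instr dX dY dX' dY (map (map (\<lambda>K. kron K (1\<^sub>m dY))) ops)"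
| localY: "\<lbrakk> \<forall>K \<in> set (concat ops). K \<in> carrier_mat dY' dY;
             kraus_sum dY (concat ops) = 1\<^sub>m dY \<rbrakk> \<Longrightarrow>
           locc_instr dX dY dX dY' (map (map (\<lambda>K. kron (1\<^sub>m dX) K)) ops)"
| compose: "\<lbrakk> locc_instr dX dY d1 d2 ops; length fs = length ops;
              \<forall>k < length ops. locc_instr d1 d2 dX' dY' (fs ! k) \<rbrakk> \<Longrightarrow>
            locc_instr dX dY dX' dY'
              (concat (map (\<lambda>k. map (\<lambda>g. concat (map (\<lambda>K. map (\<lambda>L. L * K) g) (ops ! k))) (fs ! k))
                 [0..<length ops]))"

definition locc_channel :: "nat \<Rightarrow> nat \<Rightarrow> nat \<Rightarrow> nat \<Rightarrow> complex mat list \<Rightarrow> bool" where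
  "locc_channel dX dY dX' dY' Ks \<longleftrightarrow> (\<exists>ops. locc_instr dX dY dX' dY' ops \<and> Ks = concat ops)"

definition entanglement_measure :: "(nat \<Rightarrow> nat \<Rightarrow> complex mat \<Rightarrow> real) \<Rightarrow> bool" where
  "entanglement_measure E \<longleftrightarrow>
     (\<forall>dX dY \<rho>. is_state (dX*dY) \<rho> \<longrightarrow> 0 \<le> E dX dY \<rho>) \<and>
     (\<forall>dX dY \<rho>. is_state (dX*dY) \<rho> \<longrightarrow> separable dX dY \<rho> \<longrightarrow> E dX dY \<rho> = 0) \<and>
     (\<forall>dX dY dX' dY' \<rho> Ks. is_state (dX*dY) \<rho> \<longrightarrow> locc_channel dX dY dX' dY' Ks \<longrightarrow>
        E dX' dY' (apply_kraus (dX'*dY') Ks \<rho>) \<le> E dX dY \<rho>)"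

text \<open>(V_A (x) I_B), with V_A |s_k> = |s_k>|k>, viewed as a map A(x)B \<rightarrow> (A(x)B)(x)A'.
  Output index ((x*dB + y)*dA + k), input index (x'*dB + y').\<close>
definition meas_iso_A :: "nat \<Rightarrow> nat \<Rightarrow> (nat \<Rightarrow> complex vec) \<Rightarrow> complex mat" where
  "meas_iso_A dA dB s = mat (dA*dB*dA) (dA*dB) (\<lambda>(r,c).
     (let k = r mod dA; x = (r div dA) div dB; y = (r div dA) mod dB;
          x' = c div dB; y' = c mod dB
      in if y = y' then s k $ x * cnj (s k $ x') else 0))"

text \<open>(V_A (x) V_B) viewed as a map A(x)B \<rightarrow> (A(x)B)(x)(A'(x)B').
  Output index ((x*dB + y)*(dA*dB) + (k*dB + l)), input index (x'*dB + y').\<close>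
definition meas_iso_AB :: "nat \<Rightarrow> nat \<Rightarrow> (nat \<Rightarrow> complex vec) \<Rightarrow> (nat \<Rightarrow> complex vec) \<Rightarrow> complex mat" where
  "meas_iso_AB dA dB s t = mat (dA*dB*(dA*dB)) (dA*dB) (\<lambda>(r,c).
     (let kl = r mod (dA*dB); k = kl div dB; l = kl mod dB;
          x = (r div (dA*dB)) div dB; y = (r div (dA*dB)) mod dB;
          x' = c div dB; y' = c mod dB
      in s k $ x * cnj (s k $ x') * (t l $ y * cnj (t l $ y'))))"

definition Q_A :: "(nat \<Rightarrow> nat \<Rightarrow> complex mat \<Rightarrow> real) \<Rightarrow> nat \<Rightarrow> nat \<Rightarrow> complex mat \<Rightarrow> real" where
  "Q_A E dA dB \<rho> = Inf {E (dA*dB) dA (meas_iso_A dA dB s * \<rho> * adj (meas_iso_A dA dB s)) | s. onb dA s}"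

definition Q_AB :: "(nat \<Rightarrow> nat \<Rightarrow> complex mat \<Rightarrow> real) \<Rightarrow> nat \<Rightarrow> nat \<Rightarrow> complex mat \<Rightarrow> real" where
  "Q_AB E dA dB \<rho> = Inf {E (dA*dB) (dA*dB)
       (meas_iso_AB dA dB s t * \<rho> * adj (meas_iso_AB dA dB s t)) | s t. onb dA s \<and> onb dB t}"

definition max_corr :: "nat \<Rightarrow> nat \<Rightarrow> (nat \<Rightarrow> complex vec) \<Rightarrow> (nat \<Rightarrow> complex vec) \<Rightarrow> (nat \<Rightarrow> nat \<Rightarrow> complex) \<Rightarrow> complex mat" where
  "max_corr dA dB a b r = mat (dA*dB) (dA*dB) (\<lambda>(p,q).
     (\<Sum>i<min dA dB. \<Sum>j<min dA dB.
        r i j * (a i $ (p div dB) * cnj (a j $ (q div dB))) * (b i $ (p mod dB) * cnj (b j $ (q mod dB)))))"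

end

theory Submission
  imports Defs "Jordan_Normal_Form.Determinant"
begin

text \<open>For any basis \<open>s\<close>, measuring \<open>A\<close> in the Fourier basis relative to \<open>s\<close> and undoing the resulting
  phases on \<open>A'\<close> is an LOCC protocol that turns \<open>V\<^sub>A \<rho> V\<^sub>A\<^sup>\<dagger>\<close>, cut as \<open>AB:A'\<close>, into \<open>\<rho>\<close> cut as \<open>B:A\<close>.
  Since \<open>E\<close> is not assumed to be symmetric, maximal correlation is needed to return from \<open>B:A\<close> to
  \<open>A:B\<close>, by the local channels exchanging \<open>a\<^sub>i\<close> and \<open>b\<^sub>i\<close>. The same Fourier protocol on \<open>B'\<close> and
  \<open>B\<close> reduces the two-sided measurement to the one-sided one, so \<open>E\<^sub>A\<^sub>:\<^sub>B(\<rho>)\<close> bounds both minima from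
  below. For \<open>s = a\<close> and \<open>t = b\<close> the bound is attained, because the measured state arises from \<open>\<rho>\<close> by the
  local maps \<open>a\<^sub>i \<mapsto> a\<^sub>i b\<^sub>i\<close> and \<open>b\<^sub>i \<mapsto> i\<close>, respectively \<open>b\<^sub>i \<mapsto> i i\<close>.

  Every state occurring here is \<open>G R G\<^sup>\<dagger>\<close> for the fixed coefficient matrix \<open>R\<close> and an isometry \<open>G\<close>, and
  every Kraus operator maps one such \<open>G\<close> to a multiple of the next.\<close>

section \<open>Paired indices, adjoints and Kronecker products\<close>

lemma sum_lessThan_mult:
  fixes g :: "nat \<Rightarrow> 'a::comm_monoid_add"
  shows "(\<Sum>p<a*b. g p) = (\<Sum>x<a. \<Sum>y<b. g (x*b+y))"
proof (induction a)
  case (Suc a)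
  have "(\<Sum>p<Suc a*b. g p) = (\<Sum>p<a*b. g p) + (\<Sum>p\<in>{a*b..<a*b+b}. g p)"
    by (subst sum.union_disjoint[symmetric]) (auto intro!: sum.cong)
  also have "(\<Sum>p\<in>{a*b..<a*b+b}. g p) = (\<Sum>y<b. g (a*b+y))"
    using sum.shift_bounds_nat_ivl[of g 0 "a*b" b] by (simp add: add.commute atLeast0LessThan)
  finally show ?case using Suc by simp
qed simp

lemma sum_rotate: "(\<Sum>p\<in>P. \<Sum>i\<in>I. \<Sum>j\<in>J. g p i j) = (\<Sum>i\<in>I. \<Sum>j\<in>J. \<Sum>p\<in>P. g p i j)"
  by (rule trans[OF sum.swap], rule sum.cong[OF refl], rule sum.swap)

lemma pair_index_less: "x < a \<Longrightarrow> y < b \<Longrightarrow> x*b+y < a*(b::nat)"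
  by (metis add.commute add_less_mono1 less_le_trans mult.commute mult_Suc_right Suc_leI mult_le_mono1)

lemma pair_index_cases:
  assumes "p < a*(b::nat)"
  obtains x y where "p = x*b+y" "x < a" "y < b"
proof
  show "p = (p div b)*b + p mod b" by simp
  show "p div b < a" using assms by (simp add: less_mult_imp_div_less)
  show "p mod b < b" using assms by (cases "b = 0") auto
qed

lemma pair_index_div_mod: "y < b \<Longrightarrow> (x*b+y) div b = x" "y < b \<Longrightarrow> (x*b+y) mod b = (y::nat)"
  by auto

lemma mult_entry:
  assumes "A \<in> carrier_mat n m" "B \<in> carrier_mat m l" "i < n" "j < l"
  shows "(A*B) $$ (i,j) = (\<Sum>k<m. A $$ (i,k) * B $$ (k,j))"
  using assms by (auto simp: scalar_prod_def atLeast0LessThan intro!: sum.cong)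

lemma adj_carrier [simp]: "A \<in> carrier_mat n m \<Longrightarrow> adj A \<in> carrier_mat m n"
  by (auto simp: adj_def)

lemma adj_entry: "A \<in> carrier_mat n m \<Longrightarrow> i < m \<Longrightarrow> j < n \<Longrightarrow> adj A $$ (i,j) = cnj (A $$ (j,i))"
  by (auto simp: adj_def)

lemma adj_adj [simp]: "adj (adj A) = A"
  by (auto simp: adj_def)

lemma adj_mult:
  assumes "A \<in> carrier_mat n m" "B \<in> carrier_mat m l"
  shows "adj (A*B) = adj B * adj A"
proof (rule eq_matI)
  fix i j assume "i < dim_row (adj B * adj A)" "j < dim_col (adj B * adj A)"
  then have ij: "i < l" "j < n" using assms by (auto simp: adj_def)
  have "adj (A*B) $$ (i,j) = cnj ((A*B) $$ (j,i))"
    using ij assms by (intro adj_entry[of _ n l]) auto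
  also have "\<dots> = (\<Sum>k<m. cnj (A $$ (j,k)) * cnj (B $$ (k,i)))"
    using mult_entry[OF assms ij(2,1)] by simp
  also have "\<dots> = (adj B * adj A) $$ (i,j)"
    using mult_entry[of "adj B" l m "adj A" n i j] ij assms adj_entry[OF assms(1)] adj_entry[OF assms(2)]
    by (auto intro!: sum.cong)
  finally show "adj (A*B) $$ (i,j) = (adj B * adj A) $$ (i,j)" .
qed (use assms in \<open>auto simp: adj_def\<close>)

lemma adj_smult: "adj (c \<cdot>\<^sub>m A) = cnj c \<cdot>\<^sub>m adj A"
  by (rule eq_matI) (auto simp: adj_def)

lemma smult_smult_mat: "c \<cdot>\<^sub>m (e \<cdot>\<^sub>m A) = (c * e) \<cdot>\<^sub>m (A :: complex mat)"
  by (rule eq_matI) auto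

lemma adj_one [simp]: "adj (1\<^sub>m n) = 1\<^sub>m n"
  by (rule eq_matI) (auto simp: adj_def)

lemma kron_carrier [simp]:
  "A \<in> carrier_mat n m \<Longrightarrow> B \<in> carrier_mat k l \<Longrightarrow> kron A B \<in> carrier_mat (n*k) (m*l)"
  by (auto simp: kron_def)

lemma kron_entry:
  assumes "A \<in> carrier_mat n m" "B \<in> carrier_mat k l" "x < n" "y < k" "x' < m" "y' < l"
  shows "kron A B $$ (x*k+y, x'*l+y') = A $$ (x,x') * B $$ (y,y')"
  using assms pair_index_less[of x n y k] pair_index_less[of x' m y' l] by (auto simp: kron_def)

lemma adj_kron:
  assumes A: "A \<in> carrier_mat n m" and B: "B \<in> carrier_mat k l"
  shows "adj (kron A B) = kron (adj A) (adj B)"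
proof (rule eq_matI)
  fix i j assume "i < dim_row (kron (adj A) (adj B))" "j < dim_col (kron (adj A) (adj B))"
  then have ij: "i < m*l" "j < n*k" using assms by (auto simp: adj_def kron_def)
  obtain x y where i: "i = x*l+y" "x < m" "y < l" using ij(1) by (rule pair_index_cases)
  obtain x' y' where j: "j = x'*k+y'" "x' < n" "y' < k" using ij(2) by (rule pair_index_cases)
  have "adj (kron A B) $$ (i,j) = cnj (kron A B $$ (j,i))"
    using ij assms by (intro adj_entry[of _ "n*k" "m*l"]) auto
  then show "adj (kron A B) $$ (i,j) = kron (adj A) (adj B) $$ (i,j)"
    using i j kron_entry[OF A B, of x' y' x y] kron_entry[OF adj_carrier[OF A] adj_carrier[OF B], of x y x' y']
      adj_entry[OF A, of x x'] adj_entry[OF B, of y y'] by simp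
qed (use assms in \<open>auto simp: adj_def kron_def\<close>)

lemma kron_mult:
  assumes A: "A \<in> carrier_mat n m" and B: "B \<in> carrier_mat n' m'"
    and C: "C \<in> carrier_mat m l" and D: "D \<in> carrier_mat m' l'"
  shows "kron A B * kron C D = kron (A*C) (B*D)"
proof (rule eq_matI)
  have AC: "A*C \<in> carrier_mat n l" and BD: "B*D \<in> carrier_mat n' l'" using assms by auto
  fix i j assume "i < dim_row (kron (A*C) (B*D))" "j < dim_col (kron (A*C) (B*D))"
  then have ij: "i < n*n'" "j < l*l'" using assms by (auto simp: kron_def)
  obtain x y where i: "i = x*n'+y" "x < n" "y < n'" using ij(1) by (rule pair_index_cases)
  obtain x' y' where j: "j = x'*l'+y'" "x' < l" "y' < l'" using ij(2) by (rule pair_index_cases)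
  have "(kron A B * kron C D) $$ (i,j) = (\<Sum>k<m*m'. kron A B $$ (i,k) * kron C D $$ (k,j))"
    using ij assms by (intro mult_entry) auto
  also have "\<dots> = (\<Sum>u<m. \<Sum>v<m'. (A $$ (x,u) * C $$ (u,x')) * (B $$ (y,v) * D $$ (v,y')))"
    unfolding sum_lessThan_mult using i j
    by (auto intro!: sum.cong simp: kron_entry[OF A B] kron_entry[OF C D])
  also have "\<dots> = (A*C) $$ (x,x') * (B*D) $$ (y,y')"
    using i j by (simp add: mult_entry[OF A C] mult_entry[OF B D] sum_product)
  also have "\<dots> = kron (A*C) (B*D) $$ (i,j)"
    using i j by (simp add: kron_entry[OF AC BD])
  finally show "(kron A B * kron C D) $$ (i,j) = kron (A*C) (B*D) $$ (i,j)" .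
qed (use assms in \<open>auto simp: kron_def\<close>)

lemma kron_one: "kron (1\<^sub>m n) (1\<^sub>m m) = 1\<^sub>m (n*m)"
proof (rule eq_matI)
  fix i j assume "i < dim_row (1\<^sub>m (n*m))" "j < dim_col (1\<^sub>m (n*m))"
  then have ij: "i < n*m" "j < n*m" by auto
  obtain x y where i: "i = x*m+y" "x < n" "y < m" using ij(1) by (rule pair_index_cases)
  obtain x' y' where j: "j = x'*m+y'" "x' < n" "y' < m" using ij(2) by (rule pair_index_cases)
  have "i = j \<longleftrightarrow> x = x' \<and> y = y'"
    using i j by (metis pair_index_div_mod)
  then show "kron (1\<^sub>m n) (1\<^sub>m m) $$ (i,j) = 1\<^sub>m (n*m) $$ (i,j)"
    using ij i j kron_entry[of "1\<^sub>m n" n n "1\<^sub>m m" m m x y x' y'] by auto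
qed (auto simp: kron_def)

subsection \<open>States under isometries\<close>

text \<open>Not restricted to square matrices: the one predicate covers unitary corrections,
  embeddings of C^n by orthonormal vectors, and the measurement interactions.\<close>

definition isometry :: "nat \<Rightarrow> nat \<Rightarrow> complex mat \<Rightarrow> bool" where
  "isometry d n G \<longleftrightarrow> G \<in> carrier_mat d n \<and> adj G * G = 1\<^sub>m n"

lemma inner_adj:
  assumes "G \<in> carrier_mat d n" "dim_vec v = d" "dim_vec w = n"
  shows "(\<Sum>i<d. cnj (v $ i) * (G *\<^sub>v w) $ i) = (\<Sum>j<n. cnj ((adj G *\<^sub>v v) $ j) * w $ j)"
proof -
  have "(\<Sum>i<d. cnj (v $ i) * (G *\<^sub>v w) $ i) = (\<Sum>i<d. \<Sum>j<n. cnj (v $ i) * (G $$ (i,j) * w $ j))"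
    using assms by (auto simp: scalar_prod_def sum_distrib_left atLeast0LessThan intro!: sum.cong)
  also have "\<dots> = (\<Sum>j<n. \<Sum>i<d. cnj (v $ i) * (G $$ (i,j) * w $ j))"
    by (rule sum.swap)
  also have "\<dots> = (\<Sum>j<n. cnj ((adj G *\<^sub>v v) $ j) * w $ j)"
    using assms by (auto simp: scalar_prod_def sum_distrib_right sum_distrib_left atLeast0LessThan adj_def mult_ac intro!: sum.cong)
  finally show ?thesis .
qed

text \<open>The quadratic form of \<open>G * R * adj G\<close> at \<open>v\<close> is that of
  \<open>R\<close> at \<open>adj G *\<^sub>v v\<close>. Since \<open>G\<close> is arbitrary, this
  also covers compression by \<open>adj G\<close>.\<close>

lemma psd_conj:
  assumes G: "G \<in> carrier_mat d n" and R: "psd n R"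
  shows "psd d (G * R * adj G)"
proof -
  have Rc: "R \<in> carrier_mat n n" and Rh: "adj R = R" using R by (auto simp: psd_def)
  have "adj (G * R * adj G) = G * (R * adj G)"
    using G Rc Rh adj_mult[of "G*R" d n "adj G" d] adj_mult[OF G Rc] by simp
  also have "\<dots> = G * R * adj G"
    by (rule assoc_mult_mat[OF G Rc adj_carrier[OF G], symmetric])
  finally have herm: "adj (G * R * adj G) = G * R * adj G" .
  have form: "(\<Sum>i<d. cnj (v $ i) * ((G * R * adj G) *\<^sub>v v) $ i) =
      (\<Sum>j<n. cnj ((adj G *\<^sub>v v) $ j) * (R *\<^sub>v (adj G *\<^sub>v v)) $ j)" if v: "dim_vec v = d" for v
  proof -
    have vc: "v \<in> carrier_vec d" using v by auto
    have w: "adj G *\<^sub>v v \<in> carrier_vec n" using adj_carrier[OF G] vc by auto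
    have "(G * R * adj G) *\<^sub>v v = G *\<^sub>v (R *\<^sub>v (adj G *\<^sub>v v))"
      using assoc_mult_mat_vec[of "G*R" d n "adj G" d v] assoc_mult_mat_vec[OF G Rc w] G Rc vc
      by simp
    then show ?thesis
      using inner_adj[OF G v, of "R *\<^sub>v (adj G *\<^sub>v v)"] Rc by simp
  qed
  have dim: "dim_vec (adj G *\<^sub>v v) = n" for v using G by (simp add: adj_def)
  have carrier: "G * R * adj G \<in> carrier_mat d d" using G Rc by (auto intro: mult_carrier_mat[of _ _ n])
  show ?thesis
    unfolding psd_def
  proof (intro conjI allI impI)
    fix v :: "complex vec" assume v: "dim_vec v = d"
    show "Im (\<Sum>i<d. cnj (v $ i) * ((G * R * adj G) *\<^sub>v v) $ i) = 0"
      and "0 \<le> Re (\<Sum>i<d. cnj (v $ i) * ((G * R * adj G) *\<^sub>v v) $ i)"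
      unfolding form[OF v] using R dim unfolding psd_def by blast+
  qed (fact carrier herm)+
qed

text \<open>Cyclicity of the trace brings \<open>adj G\<close> next to \<open>G\<close>, where the
  two cancel.\<close>

lemma trace_conj:
  assumes G: "isometry d n G" and R: "R \<in> carrier_mat n n"
  shows "(\<Sum>p<d. (G * R * adj G) $$ (p,p)) = (\<Sum>i<n. R $$ (i,i))"
proof -
  have Gc: "G \<in> carrier_mat d n" and GG: "adj G * G = 1\<^sub>m n" using G by (auto simp: isometry_def)
  have GR: "G * R \<in> carrier_mat d n" using Gc R by simp
  have "(\<Sum>p<d. (G * R * adj G) $$ (p,p)) = (\<Sum>p<d. \<Sum>j<n. (G*R) $$ (p,j) * adj G $$ (j,p))"
    using mult_entry[OF GR adj_carrier[OF Gc]] by simp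
  also have "\<dots> = (\<Sum>j<n. \<Sum>p<d. adj G $$ (j,p) * (G*R) $$ (p,j))"
    by (subst sum.swap) (simp add: mult.commute)
  also have "\<dots> = (\<Sum>j<n. (adj G * (G * R)) $$ (j,j))"
    using mult_entry[OF adj_carrier[OF Gc] GR] by simp
  also have "adj G * (G * R) = R"
    using assoc_mult_mat[OF adj_carrier[OF Gc] Gc R] GG R by simp
  finally show ?thesis .
qed

lemma is_state_conj:
  assumes "isometry d n G" "is_state n R"
  shows "is_state d (G * R * adj G)"
proof -
  have "G \<in> carrier_mat d n" using assms by (auto simp: isometry_def)
  moreover have "R \<in> carrier_mat n n" "psd n R" using assms by (auto simp: is_state_def psd_def)
  ultimately show ?thesis
    using psd_conj trace_conj[OF assms(1)] assms(2) by (simp add: is_state_def)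
qed

text \<open>\<open>R\<close> is recovered as the compression of the given state by
  \<open>adj G\<close>, so positivity follows from \<open>psd_conj\<close> with \<open>adj G\<close>
  in place of \<open>G\<close>. This transfers the assumption on the maximally correlated state to
  its coefficient matrix.\<close>

lemma is_state_conjD:
  assumes G: "isometry d n G" and R: "R \<in> carrier_mat n n" and S: "is_state d (G * R * adj G)"
  shows "is_state n R"
proof -
  have Gc: "G \<in> carrier_mat d n" and GG: "adj G * G = 1\<^sub>m n" using G by (auto simp: isometry_def)
  have "adj G * (G * R * adj G) * adj (adj G) = R"
  proof -
    have "adj G * (G * R * adj G) = adj G * (G * R) * adj G"
      using Gc R by (simp add: assoc_mult_mat[of "adj G" n d "G*R" n "adj G" d])
    also have "adj G * (G * R) = R"
      using assoc_mult_mat[OF adj_carrier[OF Gc] Gc R] GG R by simp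
    finally have "adj G * (G * R * adj G) * adj (adj G) = R * adj G * G" by simp
    also have "\<dots> = R * (adj G * G)" using Gc R by (simp add: assoc_mult_mat[OF R adj_carrier[OF Gc] Gc])
    finally show ?thesis using GG R by simp
  qed
  moreover have "psd n (adj G * (G * R * adj G) * adj (adj G))"
    using S Gc by (intro psd_conj[of _ n d]) (auto simp: is_state_def)
  ultimately show ?thesis
    using trace_conj[OF G R] S by (simp add: is_state_def)
qed

subsection \<open>One-way protocols\<close>

lemma kraus_sum_entry:
  assumes "\<forall>K\<in>set Ks. K \<in> carrier_mat d' d" "i < d" "j < d"
  shows "kraus_sum d Ks \<in> carrier_mat d d \<and>
    kraus_sum d Ks $$ (i,j) = (\<Sum>K\<leftarrow>Ks. (adj K * K) $$ (i,j))"
  using assms(1)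
proof (induction Ks)
  case (Cons K Ks)
  then have "adj K * K \<in> carrier_mat d d" by (auto intro: mult_carrier_mat[of _ _ d'])
  then show ?case using Cons assms by (auto simp: kraus_sum_def)
qed (use assms in \<open>auto simp: kraus_sum_def\<close>)

text \<open>\<open>kraus_sum_entry\<close> yields the dimensions of the sum only together with a
  pair of valid indices; \<open>0 < d\<close> provides one.\<close>

lemma kraus_sum_eq_one:
  assumes "\<And>m. m < M \<Longrightarrow> K m \<in> carrier_mat d' d" "0 < d"
    and "\<And>i j. i < d \<Longrightarrow> j < d \<Longrightarrow> (\<Sum>m<M. (adj (K m) * K m) $$ (i,j)) = (if i = j then 1 else 0)"
  shows "kraus_sum d (map K [0..<M]) = 1\<^sub>m d"
proof -
  have *: "\<forall>K\<in>set (map K [0..<M]). K \<in> carrier_mat d' d" using assms(1) by auto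
  show ?thesis
    using kraus_sum_entry[OF *] assms(2,3)
    by (intro eq_matI) (auto simp: comp_def interv_sum_list_conv_sum_set_nat atLeast0LessThan)
qed

text \<open>All Kraus operators map \<open>G\<close> to multiples of the same \<open>G'\<close>, so
  every branch yields the same matrix with weight |c m|^2, and the branches add up.\<close>

lemma apply_kraus_conj:
  assumes G: "G \<in> carrier_mat d n" and G': "G' \<in> carrier_mat d' n" and R: "R \<in> carrier_mat n n"
    and "\<And>m. m \<in> set ms \<Longrightarrow> K m \<in> carrier_mat d' d"
    and "\<And>m. m \<in> set ms \<Longrightarrow> K m * G = c m \<cdot>\<^sub>m G'"
  shows "apply_kraus d' (map K ms) (G * R * adj G) = (\<Sum>m\<leftarrow>ms. c m * cnj (c m)) \<cdot>\<^sub>m (G' * R * adj G')"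
  using assms(4,5)
proof (induction ms)
  case Nil
  show ?case using G' by (intro eq_matI) (auto simp: apply_kraus_def adj_def)
next
  case (Cons m ms)
  have Kc: "K m \<in> carrier_mat d' d" and KG: "K m * G = c m \<cdot>\<^sub>m G'" using Cons.prems by auto
  have GR: "G * R \<in> carrier_mat d n" and GR': "G' * R \<in> carrier_mat d' n" using G G' R by auto
  have "K m * (G * R * adj G) * adj (K m) = (K m * G * R) * (adj G * adj (K m))"
  proof -
    have "K m * (G * R * adj G) = K m * G * R * adj G"
      using assoc_mult_mat[OF Kc GR adj_carrier[OF G]] assoc_mult_mat[OF Kc G R] by simp
    moreover have "K m * G * R \<in> carrier_mat d' n" using Kc G R by simp
    ultimately show ?thesis
      using assoc_mult_mat[of "K m * G * R" d' n "adj G" d "adj (K m)" d'] G Kc by simp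
  qed
  also have "adj G * adj (K m) = cnj (c m) \<cdot>\<^sub>m adj G'"
    using adj_mult[OF Kc G] KG by (simp add: adj_smult)
  also have "K m * G * R = c m \<cdot>\<^sub>m (G' * R)"
    using G' R KG by (simp add: mult_smult_assoc_mat)
  also have "(c m \<cdot>\<^sub>m (G' * R)) * (cnj (c m) \<cdot>\<^sub>m adj G') = (c m * cnj (c m)) \<cdot>\<^sub>m (G' * R * adj G')"
    using GR' adj_carrier[OF G']
    by (simp add: mult_smult_assoc_mat[of _ d' n] mult_smult_distrib[of _ d' n _ d'] smult_smult_mat mult.commute)
  finally have step: "K m * (G * R * adj G) * adj (K m) = (c m * cnj (c m)) \<cdot>\<^sub>m (G' * R * adj G')" .
  have IH: "apply_kraus d' (map K ms) (G * R * adj G) = (\<Sum>m\<leftarrow>ms. c m * cnj (c m)) \<cdot>\<^sub>m (G' * R * adj G')"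
    using Cons by auto
  then show ?case
    using step add_smult_distrib_right_mat[OF mult_carrier_mat[OF GR' adj_carrier[OF G']]] by (simp add: apply_kraus_def)
qed

text \<open>One-way communication from X to Y: X measures with one Kraus operator \<open>K m\<close>
  per outcome, and Y applies an isometry \<open>U m\<close> chosen by the outcome.\<close>

lemma locc_channel_XY:
  assumes K: "\<And>m. m < M \<Longrightarrow> K m \<in> carrier_mat dX' dX" and U: "\<And>m. m < M \<Longrightarrow> isometry dY' dY (U m)"
    and KK: "kraus_sum dX (map K [0..<M]) = 1\<^sub>m dX"
  shows "locc_channel dX dY dX' dY' (map (\<lambda>m. kron (K m) (U m)) [0..<M])"
proof -
  \<comment> \<open>Each \<open>K m\<close> forms an outcome of its own. Operators inside one
    outcome are not distinguished by the classical record, so grouping them would prevent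
    conditioning on \<open>m\<close>.\<close>
  let ?ops = "map (map (\<lambda>K. kron K (1\<^sub>m dY))) (map (\<lambda>m. [K m]) [0..<M])"
  let ?fs = "map (\<lambda>m. map (map (\<lambda>L. kron (1\<^sub>m dX') L)) [[U m]]) [0..<M]"
  have cc: "concat (map (\<lambda>m. [K m]) [0..<M]) = map K [0..<M]" by simp
  have 1: "locc_instr dX dY dX' dY ?ops"
    by (rule locc_instr.localX) (unfold cc, use K KK in auto)
  have 2: "locc_instr dX' dY dX' dY' (?fs ! m)" if "m < length ?ops" for m
  proof -
    have "adj (U m) * U m + 0\<^sub>m dY dY = 1\<^sub>m dY" "U m \<in> carrier_mat dY' dY"
      using U[of m] that by (auto simp: isometry_def)
    then have "locc_instr dX' dY dX' dY' (map (map (\<lambda>L. kron (1\<^sub>m dX') L)) [[U m]])"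
      by (intro locc_instr.localY) (auto simp: kraus_sum_def)
    then show ?thesis using that by simp
  qed
  have fuse: "kron (1\<^sub>m dX') (U m) * kron (K m) (1\<^sub>m dY) = kron (K m) (U m)" if "m < M" for m
  proof -
    have "K m \<in> carrier_mat dX' dX" "U m \<in> carrier_mat dY' dY" using K U that by (auto simp: isometry_def)
    then show ?thesis using kron_mult[of "1\<^sub>m dX'" dX' dX' "U m" dY' dY "K m" dX "1\<^sub>m dY" dY] by simp
  qed
  have "locc_instr dX dY dX' dY' (concat (map (\<lambda>k. map (\<lambda>g. concat (map (\<lambda>K. map (\<lambda>L. L * K) g) (?ops ! k))) (?fs ! k))
                 [0..<length ?ops]))"
    by (rule locc_instr.compose[OF 1]) (use 2 in auto)
  \<comment> \<open>Every outcome and every follow-up instrument is a singleton, so composition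
    leaves exactly one product per \<open>m\<close>, which \<open>fuse\<close> turns into
    \<open>kron (K m) (U m)\<close>.\<close>
  also have "(concat (map (\<lambda>k. map (\<lambda>g. concat (map (\<lambda>K. map (\<lambda>L. L * K) g) (?ops ! k))) (?fs ! k))
                 [0..<length ?ops])) = concat (map (\<lambda>m. [[kron (K m) (U m)]]) [0..<M])"
    using fuse by (intro arg_cong[of _ _ concat] map_cong) auto
  finally show ?thesis unfolding locc_channel_def by (intro exI conjI) (assumption, simp)
qed

text \<open>The mirror image: Y measures and X corrects. It serves the step in which
  \<open>B'\<close>, held by the second party, is measured.\<close>

lemma locc_channel_YX:
  assumes L: "\<And>m. m < M \<Longrightarrow> L m \<in> carrier_mat dY' dY" and U: "\<And>m. m < M \<Longrightarrow> isometry dX' dX (U m)"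
    and LL: "kraus_sum dY (map L [0..<M]) = 1\<^sub>m dY"
  shows "locc_channel dX dY dX' dY' (map (\<lambda>m. kron (U m) (L m)) [0..<M])"
proof -
  let ?ops = "map (map (\<lambda>L. kron (1\<^sub>m dX) L)) (map (\<lambda>m. [L m]) [0..<M])"
  let ?fs = "map (\<lambda>m. map (map (\<lambda>U. kron U (1\<^sub>m dY'))) [[U m]]) [0..<M]"
  have cc: "concat (map (\<lambda>m. [L m]) [0..<M]) = map L [0..<M]" by simp
  have 1: "locc_instr dX dY dX dY' ?ops"
    by (rule locc_instr.localY) (unfold cc, use L LL in auto)
  have 2: "locc_instr dX dY' dX' dY' (?fs ! m)" if "m < length ?ops" for m
  proof -
    have "adj (U m) * U m + 0\<^sub>m dX dX = 1\<^sub>m dX" "U m \<in> carrier_mat dX' dX"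
      using U[of m] that by (auto simp: isometry_def)
    then have "locc_instr dX dY' dX' dY' (map (map (\<lambda>U. kron U (1\<^sub>m dY'))) [[U m]])"
      by (intro locc_instr.localX) (auto simp: kraus_sum_def)
    then show ?thesis using that by simp
  qed
  have fuse: "kron (U m) (1\<^sub>m dY') * kron (1\<^sub>m dX) (L m) = kron (U m) (L m)" if "m < M" for m
  proof -
    have "L m \<in> carrier_mat dY' dY" "U m \<in> carrier_mat dX' dX" using L U that by (auto simp: isometry_def)
    then show ?thesis using kron_mult[of "U m" dX' dX "1\<^sub>m dY'" dY' dY' "1\<^sub>m dX" dX "L m" dY] by simp
  qed
  have "locc_instr dX dY dX' dY' (concat (map (\<lambda>k. map (\<lambda>g. concat (map (\<lambda>K. map (\<lambda>L. L * K) g) (?ops ! k))) (?fs ! k))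
                 [0..<length ?ops]))"
    by (rule locc_instr.compose[OF 1]) (use 2 in auto)
  also have "(concat (map (\<lambda>k. map (\<lambda>g. concat (map (\<lambda>K. map (\<lambda>L. L * K) g) (?ops ! k))) (?fs ! k))
                 [0..<length ?ops])) = concat (map (\<lambda>m. [[kron (U m) (L m)]]) [0..<M])"
    using fuse by (intro arg_cong[of _ _ concat] map_cong) auto
  finally show ?thesis unfolding locc_channel_def by (intro exI conjI) (assumption, simp)
qed

text \<open>The form in which monotonicity is used throughout: it reduces every comparison of
  \<open>E\<close> to an identity \<open>K m * G = c m \<cdot>\<^sub>m G'\<close>. As the weights
  sum to 1, the output of the channel is exactly \<open>G' * R * adj G'\<close>.\<close>

lemma entanglement_mono:
  assumes E: "entanglement_measure E" and R: "is_state n R"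
    and G: "isometry (dX*dY) n G" and G': "G' \<in> carrier_mat (dX'*dY') n"
    and locc: "locc_channel dX dY dX' dY' (map K [0..<M])"
    and K: "\<And>m. m < M \<Longrightarrow> K m \<in> carrier_mat (dX'*dY') (dX*dY)"
    and KG: "\<And>m. m < M \<Longrightarrow> K m * G = c m \<cdot>\<^sub>m G'"
    and c: "(\<Sum>m<M. c m * cnj (c m)) = 1"
  shows "E dX' dY' (G' * R * adj G') \<le> E dX dY (G * R * adj G)"
proof -
  have Rc: "R \<in> carrier_mat n n" using R by (auto simp: is_state_def psd_def)
  have Gc: "G \<in> carrier_mat (dX*dY) n" using G by (auto simp: isometry_def)
  have "apply_kraus (dX'*dY') (map K [0..<M]) (G * R * adj G) = (\<Sum>m\<leftarrow>[0..<M]. c m * cnj (c m)) \<cdot>\<^sub>m (G' * R * adj G')"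
    using K KG by (intro apply_kraus_conj[OF Gc G' Rc]) auto
  also have "(\<Sum>m\<leftarrow>[0..<M]. c m * cnj (c m)) = 1"
    using c by (simp add: interv_sum_list_conv_sum_set_nat atLeast0LessThan)
  also have "1 \<cdot>\<^sub>m (G' * R * adj G') = G' * R * adj G'" by (intro eq_matI) auto
  finally show ?thesis
    using E locc is_state_conj[OF G R] unfolding entanglement_measure_def by metis
qed


subsection \<open>Orthonormal families\<close>

text \<open>Families of \<open>n\<close> vectors in dimension \<open>d\<close> are needed besides
  bases: a maximally correlated state involves only the first \<open>min dA dB\<close> vectors of
  the larger basis, and families in enlarged spaces such as a_i (x) b_i are incomplete.\<close>

definition ons :: "nat \<Rightarrow> nat \<Rightarrow> (nat \<Rightarrow> complex vec) \<Rightarrow> bool" where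
  "ons n d x \<longleftrightarrow> (\<forall>k<n. dim_vec (x k) = d) \<and>
     (\<forall>k<n. \<forall>l<n. (\<Sum>i<d. cnj (x k $ i) * x l $ i) = (if k = l then 1 else 0))"

lemma ons_inner: "ons n d x \<Longrightarrow> k < n \<Longrightarrow> l < n \<Longrightarrow> (\<Sum>i<d. cnj (x k $ i) * x l $ i) = (if k = l then 1 else 0)"
  by (auto simp: ons_def)

lemma ons_mono: "ons n d x \<Longrightarrow> m \<le> n \<Longrightarrow> ons m d x"
  by (auto simp: ons_def)

lemma onb_iff_ons: "onb d x \<longleftrightarrow> ons d d x"
  by (simp add: onb_def ons_def)

lemma ons_unit_vec:
  assumes "\<And>i. i < n \<Longrightarrow> f i < d" "inj_on f {..<n}"
  shows "ons n d (\<lambda>i. unit_vec d (f i))"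
proof -
  have "(\<Sum>i<d. cnj (unit_vec d (f k) $ i) * unit_vec d (f l) $ i) = (if k = l then 1 else 0 :: complex)"
    if kl: "k < n" "l < n" for k l
  proof -
    have "(\<Sum>i<d. cnj (unit_vec d (f k) $ i) * unit_vec d (f l) $ i) =
        (\<Sum>i<d. if i = f k then (if f k = f l then 1 else 0) else 0 :: complex)"
      using assms(1) kl by (intro sum.cong) (auto simp: unit_vec_def)
    also have "\<dots> = (if f k = f l then 1 else 0)" using assms(1) kl by simp
    also have "f k = f l \<longleftrightarrow> k = l" using assms(2) kl by (auto dest: inj_onD)
    finally show ?thesis .
  qed
  then show ?thesis by (simp add: ons_def)
qed

text \<open>Orthonormality says that the square matrix \<open>S\<close> of basis vectors has left
  inverse \<open>adj S\<close>; in finite dimension this is also a right inverse, which is the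
  completeness relation.\<close>

lemma onb_complete:
  assumes "onb d s" "x < d" "y < d"
  shows "(\<Sum>k<d. s k $ x * cnj (s k $ y)) = (if x = y then 1 else 0)"
proof -
  define S where "S = mat d d (\<lambda>(i,k). s k $ i)"
  have S: "S \<in> carrier_mat d d" by (simp add: S_def)
  have "adj S * S = 1\<^sub>m d"
  proof (rule eq_matI)
    fix i j assume "i < dim_row (1\<^sub>m d)" "j < dim_col (1\<^sub>m d)"
    then show "(adj S * S) $$ (i,j) = 1\<^sub>m d $$ (i,j)"
      using assms(1) mult_entry[OF adj_carrier[OF S] S, of i j] adj_entry[OF S]
      by (auto simp: onb_def S_def)
  qed (auto simp: adj_def S_def)
  then have "S * adj S = 1\<^sub>m d"
    using mat_mult_left_right_inverse[OF adj_carrier[OF S] S] by simp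
  moreover have "(S * adj S) $$ (x,y) = (\<Sum>k<d. s k $ x * cnj (s k $ y))"
    using mult_entry[OF S adj_carrier[OF S] assms(2,3)] adj_entry[OF S] assms by (simp add: S_def)
  ultimately show ?thesis using assms by simp
qed

lemma onb_expand:
  assumes "onb d s" "x < d"
  shows "(\<Sum>k<d. s k $ x * (\<Sum>y<d. cnj (s k $ y) * v y)) = v x"
proof -
  have "(\<Sum>k<d. s k $ x * (\<Sum>y<d. cnj (s k $ y) * v y)) = (\<Sum>k<d. \<Sum>y<d. s k $ x * cnj (s k $ y) * v y)"
    by (simp add: sum_distrib_left mult.assoc)
  also have "\<dots> = (\<Sum>y<d. (\<Sum>k<d. s k $ x * cnj (s k $ y)) * v y)"
    by (subst sum.swap) (simp add: sum_distrib_right)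
  also have "\<dots> = (\<Sum>y<d. if y = x then v y else 0)"
    using assms by (intro sum.cong) (auto simp: onb_complete)
  finally show ?thesis using assms by simp
qed

text \<open>For orthonormal \<open>x\<close> and \<open>y\<close> this is the isometry |i> -> x_i
  (x) y_i; conjugating a coefficient matrix by it gives a maximally correlated state.\<close>

definition tprod :: "nat \<Rightarrow> nat \<Rightarrow> nat \<Rightarrow> (nat \<Rightarrow> complex vec) \<Rightarrow> (nat \<Rightarrow> complex vec) \<Rightarrow> complex mat" where
  "tprod n dX dY x y = mat (dX*dY) n (\<lambda>(p,i). x i $ (p div dY) * y i $ (p mod dY))"

lemma tprod_carrier [simp]: "tprod n dX dY x y \<in> carrier_mat (dX*dY) n"
  by (simp add: tprod_def)

lemma tprod_entry:
  "p < dX \<Longrightarrow> q < dY \<Longrightarrow> i < n \<Longrightarrow> tprod n dX dY x y $$ (p*dY+q, i) = x i $ p * y i $ q"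
  using pair_index_less[of p dX q dY] by (simp add: tprod_def)

lemma tprod_isometry:
  assumes "ons n dX x" "ons n dY y"
  shows "isometry (dX*dY) n (tprod n dX dY x y)"
proof -
  let ?T = "tprod n dX dY x y"
  have "adj ?T * ?T = 1\<^sub>m n"
  proof (rule eq_matI)
    fix i j assume "i < dim_row (1\<^sub>m n)" "j < dim_col (1\<^sub>m n)"
    then have ij: "i < n" "j < n" by auto
    have "(adj ?T * ?T) $$ (i,j) = (\<Sum>p<dX*dY. cnj (?T $$ (p,i)) * ?T $$ (p,j))"
      using ij mult_entry[OF adj_carrier[OF tprod_carrier] tprod_carrier] adj_entry[OF tprod_carrier] by simp
    also have "\<dots> = (\<Sum>p<dX. \<Sum>q<dY. (cnj (x i $ p) * x j $ p) * (cnj (y i $ q) * y j $ q))"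
      unfolding sum_lessThan_mult using ij by (intro sum.cong) (auto simp: tprod_entry)
    also have "\<dots> = (if i = j then 1 else 0)"
      using ij assms by (simp add: sum_product[symmetric] ons_inner)
    finally show "(adj ?T * ?T) $$ (i,j) = 1\<^sub>m n $$ (i,j)" using ij by simp
  qed (auto simp: tprod_def adj_def)
  then show ?thesis by (simp add: isometry_def)
qed

text \<open>Brings the given state into the form \<open>G * R * adj G\<close> on which all later
  steps operate.\<close>

lemma max_corr_eq:
  assumes n_def: "n = min dA dB"
  shows "max_corr dA dB a b r =
    tprod n dA dB a b * mat n n (\<lambda>(i,j). r i j) * adj (tprod n dA dB a b)"
proof -
  define T where "T = tprod n dA dB a b"
  define R where "R = mat n n (\<lambda>(i,j). r i j)"
  have T: "T \<in> carrier_mat (dA*dB) n" and R: "R \<in> carrier_mat n n" by (auto simp: T_def R_def)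
  have TR: "T * R \<in> carrier_mat (dA*dB) n" using T R by simp
  have "max_corr dA dB a b r = T * R * adj T"
  proof (rule eq_matI)
    fix p q assume "p < dim_row (T * R * adj T)" "q < dim_col (T * R * adj T)"
    then have pq: "p < dA*dB" "q < dA*dB" using T by (auto simp: adj_def)
    have "(T * R * adj T) $$ (p,q) = (\<Sum>j<n. (\<Sum>i<n. T $$ (p,i) * R $$ (i,j)) * cnj (T $$ (q,j)))"
      using pq mult_entry[OF TR adj_carrier[OF T]] mult_entry[OF T R] adj_entry[OF T] by simp
    also have "\<dots> = (\<Sum>j<n. \<Sum>i<n. r i j * (a i $ (p div dB) * cnj (a j $ (q div dB))) * (b i $ (p mod dB) * cnj (b j $ (q mod dB))))"
      unfolding sum_distrib_right using pq by (intro sum.cong) (auto simp: T_def R_def tprod_def)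
    also have "\<dots> = max_corr dA dB a b r $$ (p,q)"
      using pq by (subst sum.swap) (simp add: max_corr_def n_def)
    finally show "max_corr dA dB a b r $$ (p,q) = (T * R * adj T) $$ (p,q)" by simp
  qed (use T in \<open>auto simp: max_corr_def adj_def\<close>)
  then show ?thesis by (simp add: T_def R_def)
qed

subsection \<open>Local conversion of the vectors of a maximally correlated state\<close>

text \<open>A product operator acts on each column x_i (x) y_i factor by factor. The scalars
  \<open>c\<close> and \<open>c'\<close> must not depend on \<open>i\<close>; this is what preserves
  the coherences between different columns.\<close>

lemma kron_tprod:
  assumes K: "K \<in> carrier_mat dX' dX" and L: "L \<in> carrier_mat dY' dY"
    and "\<And>i p. i < n \<Longrightarrow> p < dX' \<Longrightarrow> (\<Sum>q<dX. K $$ (p,q) * x i $ q) = c * x' i $ p"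
    and "\<And>i p. i < n \<Longrightarrow> p < dY' \<Longrightarrow> (\<Sum>q<dY. L $$ (p,q) * y i $ q) = c' * y' i $ p"
  shows "kron K L * tprod n dX dY x y = (c*c') \<cdot>\<^sub>m tprod n dX' dY' x' y'"
proof (rule eq_matI)
  fix p i assume "p < dim_row ((c*c') \<cdot>\<^sub>m tprod n dX' dY' x' y')" "i < dim_col ((c*c') \<cdot>\<^sub>m tprod n dX' dY' x' y')"
  then have p: "p < dX'*dY'" and i: "i < n" by (auto simp: tprod_def)
  obtain u v where uv: "p = u*dY'+v" "u < dX'" "v < dY'" using p by (rule pair_index_cases)
  have "(kron K L * tprod n dX dY x y) $$ (p,i) = (\<Sum>q<dX*dY. kron K L $$ (p,q) * tprod n dX dY x y $$ (q,i))"
    using K L p i by (intro mult_entry[of _ "dX'*dY'"]) auto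
  also have "\<dots> = (\<Sum>q<dX. \<Sum>q'<dY. (K $$ (u,q) * x i $ q) * (L $$ (v,q') * y i $ q'))"
    unfolding sum_lessThan_mult using uv i by (intro sum.cong) (auto simp: tprod_entry kron_entry[OF K L])
  also have "\<dots> = (c * x' i $ u) * (c' * y' i $ v)"
    using uv i assms(3,4) by (simp add: sum_product[symmetric])
  finally show "(kron K L * tprod n dX dY x y) $$ (p,i) = ((c*c') \<cdot>\<^sub>m tprod n dX' dY' x' y') $$ (p,i)"
    using p i uv tprod_entry[of u dX' v dY' i n x' y'] by (simp add: tprod_def)
qed (use K L in \<open>auto simp: tprod_def kron_def\<close>)

text \<open>The basis vectors outside the span of the first \<open>n\<close> ones are all sent to one fixed vector;
  these Kraus operators annihilate the state but are needed for trace preservation when \<open>d' < d\<close>.\<close>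

lemma local_conversion:
  assumes x: "onb d x" and n: "0 < n" "n \<le> d" and x': "ons n d' x'"
  obtains K c where "\<And>m. m < Suc d \<Longrightarrow> K m \<in> carrier_mat d' d"
    "kraus_sum d (map K [0..<Suc d]) = 1\<^sub>m d"
    "\<And>m i p. m < Suc d \<Longrightarrow> i < n \<Longrightarrow> p < d' \<Longrightarrow> (\<Sum>q<d. K m $$ (p,q) * x i $ q) = c m * x' i $ p"
    "(\<Sum>m<Suc d. c m * cnj (c m)) = (1::complex)"
proof -
  \<comment> \<open>\<open>K 0\<close> is the sum of |x'_i><x_i| over i < n and acts on the state
    without loss. For j >= n, \<open>K (Suc j)\<close> is |x'_0><x_j|; for j < n it is zero, which
    merely keeps the index range uniform.\<close>
  define K where "K m = mat d' d (\<lambda>(p,q). case m of 0 \<Rightarrow> (\<Sum>i<n. x' i $ p * cnj (x i $ q))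
      | Suc j \<Rightarrow> if j < n then 0 else x' 0 $ p * cnj (x j $ q))" for m
  define c :: "nat \<Rightarrow> complex" where "c m = (if m = 0 then 1 else 0)" for m
  have Kc: "K m \<in> carrier_mat d' d" for m by (simp add: K_def)
  have inner: "(\<Sum>q<d. cnj (x k $ q) * x l $ q) = (if k = l then 1 else 0)" if "k < d" "l < d" for k l
    using x that by (simp add: onb_def)
  have "kraus_sum d (map K [0..<Suc d]) = 1\<^sub>m d"
  proof (rule kraus_sum_eq_one)
    fix q r assume qr: "q < d" "r < d"
    have ent: "(adj (K m) * K m) $$ (q,r) = (\<Sum>p<d'. cnj (K m $$ (p,q)) * K m $$ (p,r))" for m
      using mult_entry[OF adj_carrier[OF Kc] Kc qr] adj_entry[OF Kc] qr by simp
    have "(adj (K 0) * K 0) $$ (q,r) = (\<Sum>p<d'. \<Sum>i<n. \<Sum>j<n. (x i $ q * cnj (x j $ r)) * (cnj (x' i $ p) * x' j $ p))"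
      unfolding ent using qr by (auto simp: K_def sum_product mult_ac intro!: sum.cong)
    also have "\<dots> = (\<Sum>i<n. \<Sum>j<n. (x i $ q * cnj (x j $ r)) * (\<Sum>p<d'. cnj (x' i $ p) * x' j $ p))"
      unfolding sum_distrib_left
      by (rule sum_rotate)
    also have "\<dots> = (\<Sum>i<n. \<Sum>j<n. if j = i then x i $ q * cnj (x j $ r) else 0)"
      using ons_inner[OF x'] by (intro sum.cong) auto
    also have "\<dots> = (\<Sum>i<n. x i $ q * cnj (x i $ r))" by simp
    finally have K0: "(adj (K 0) * K 0) $$ (q,r) = (\<Sum>i<n. x i $ q * cnj (x i $ r))" .
    have KS: "(adj (K (Suc j)) * K (Suc j)) $$ (q,r) = (if j < n then 0 else x j $ q * cnj (x j $ r))" for j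
    proof (cases "j < n")
      case False
      have "(adj (K (Suc j)) * K (Suc j)) $$ (q,r) = (\<Sum>p<d'. (x j $ q * cnj (x j $ r)) * (cnj (x' 0 $ p) * x' 0 $ p))"
        unfolding ent using qr False by (auto simp: K_def mult_ac intro!: sum.cong)
      also have "\<dots> = x j $ q * cnj (x j $ r)"
        using ons_inner[OF x' n(1) n(1)] by (simp add: sum_distrib_left[symmetric])
      finally show ?thesis using False by simp
    qed (unfold ent, use qr in \<open>simp add: K_def\<close>)
    \<comment> \<open>The first term is the projector onto the span of the first \<open>n\<close>
      basis vectors, the second the projector onto the remaining ones; completeness of
      \<open>x\<close> makes their sum the identity.\<close>
    have "(\<Sum>m<Suc d. (adj (K m) * K m) $$ (q,r)) =
        (\<Sum>i<n. x i $ q * cnj (x i $ r)) + (\<Sum>j<d. if j < n then 0 else x j $ q * cnj (x j $ r))"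
      unfolding sum.lessThan_Suc_shift K0 KS ..
    also have "(\<Sum>i<n. x i $ q * cnj (x i $ r)) = (\<Sum>j<d. if j < n then x j $ q * cnj (x j $ r) else 0)"
      using n by (intro sum.mono_neutral_cong_left) auto
    also have "\<dots> + (\<Sum>j<d. if j < n then 0 else x j $ q * cnj (x j $ r)) = (\<Sum>j<d. x j $ q * cnj (x j $ r))"
      unfolding sum.distrib[symmetric] by (intro sum.cong) auto
    finally show "(\<Sum>m<Suc d. (adj (K m) * K m) $$ (q,r)) = (if q = r then 1 else 0)"
      using onb_complete[OF x qr] by simp
  qed (use Kc n in auto)
  moreover have "(\<Sum>q<d. K m $$ (p,q) * x i $ q) = c m * x' i $ p" if m: "m < Suc d" "i < n" "p < d'" for m i p
  proof (cases m)
    case 0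
    have "(\<Sum>q<d. K m $$ (p,q) * x i $ q) = (\<Sum>q<d. \<Sum>j<n. x' j $ p * (cnj (x j $ q) * x i $ q))"
      using m 0 by (intro sum.cong refl) (simp add: K_def sum_distrib_right mult.assoc)
    also have "\<dots> = (\<Sum>j<n. x' j $ p * (\<Sum>q<d. cnj (x j $ q) * x i $ q))"
      by (subst sum.swap) (simp add: sum_distrib_left)
    also have "\<dots> = (\<Sum>j<n. if j = i then x' j $ p else 0)"
      using inner m n by (intro sum.cong) auto
    finally show ?thesis using m 0 by (simp add: c_def)
  next
    case (Suc j)
    have "(\<Sum>q<d. K m $$ (p,q) * x i $ q) = (if j < n then 0 else x' 0 $ p * (\<Sum>q<d. cnj (x j $ q) * x i $ q))"
      using m Suc by (auto simp: K_def sum_distrib_left mult_ac intro!: sum.cong)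
    then show ?thesis using inner[of j i] m n Suc by (auto simp: c_def)
  qed
  moreover have "(\<Sum>m<Suc d. c m * cnj (c m)) = 1" unfolding sum.lessThan_Suc_shift by (simp add: c_def)
  ultimately show thesis using that Kc by blast
qed

lemma isometry_one: "isometry d d (1\<^sub>m d)"
  by (simp add: isometry_def)

lemma one_mat_sum: "p < d \<Longrightarrow> (\<Sum>q<d. 1\<^sub>m d $$ (p,q) * f q) = (f p :: complex)"
proof -
  assume "p < d"
  then have "(\<Sum>q<d. 1\<^sub>m d $$ (p,q) * f q) = (\<Sum>q<d. if q = p then f q else 0)"
    by (intro sum.cong) auto
  then show ?thesis using \<open>p < d\<close> by simp
qed

text \<open>A channel on X alone exchanges the vectors there. The source \<open>x\<close> is a full
  basis because the Kraus operators have to be trace preserving on all of X, while the target may be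
  any orthonormal family, in any dimension.\<close>

lemma convert_X:
  assumes E: "entanglement_measure E" and R: "is_state n R" and n: "0 < n" "n \<le> dX"
    and x: "onb dX x" and x': "ons n dX' x'" and y: "ons n dY y"
  shows "E dX' dY (tprod n dX' dY x' y * R * adj (tprod n dX' dY x' y))
       \<le> E dX dY (tprod n dX dY x y * R * adj (tprod n dX dY x y))"
proof -
  obtain K c where K: "\<And>m. m < Suc dX \<Longrightarrow> K m \<in> carrier_mat dX' dX"
    "kraus_sum dX (map K [0..<Suc dX]) = 1\<^sub>m dX"
    "\<And>m i p. m < Suc dX \<Longrightarrow> i < n \<Longrightarrow> p < dX' \<Longrightarrow> (\<Sum>q<dX. K m $$ (p,q) * x i $ q) = c m * x' i $ p"
    "(\<Sum>m<Suc dX. c m * cnj (c m)) = (1::complex)"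
    using local_conversion[OF x n x'] by blast
  have xn: "ons n dX x" using x n ons_mono by (auto simp: onb_iff_ons)
  show ?thesis
  proof (rule entanglement_mono[OF E R tprod_isometry[OF xn y] tprod_carrier])
    show "locc_channel dX dY dX' dY (map (\<lambda>m. kron (K m) (1\<^sub>m dY)) [0..<Suc dX])"
      using K(1,2) isometry_one by (intro locc_channel_XY)
    show "kron (K m) (1\<^sub>m dY) * tprod n dX dY x y = c m \<cdot>\<^sub>m tprod n dX' dY x' y" if "m < Suc dX" for m
    proof -
      have "kron (K m) (1\<^sub>m dY) * tprod n dX dY x y = (c m * 1) \<cdot>\<^sub>m tprod n dX' dY x' y"
        using K(1,3) that by (intro kron_tprod) (auto simp: one_mat_sum simp del: index_one_mat)
      then show ?thesis by simp
    qed
  qed (use K in auto)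
qed

lemma convert_Y:
  assumes E: "entanglement_measure E" and R: "is_state n R" and n: "0 < n" "n \<le> dY"
    and y: "onb dY y" and y': "ons n dY' y'" and x: "ons n dX x"
  shows "E dX dY' (tprod n dX dY' x y' * R * adj (tprod n dX dY' x y'))
       \<le> E dX dY (tprod n dX dY x y * R * adj (tprod n dX dY x y))"
proof -
  obtain K c where K: "\<And>m. m < Suc dY \<Longrightarrow> K m \<in> carrier_mat dY' dY"
    "kraus_sum dY (map K [0..<Suc dY]) = 1\<^sub>m dY"
    "\<And>m i p. m < Suc dY \<Longrightarrow> i < n \<Longrightarrow> p < dY' \<Longrightarrow> (\<Sum>q<dY. K m $$ (p,q) * y i $ q) = c m * y' i $ p"
    "(\<Sum>m<Suc dY. c m * cnj (c m)) = (1::complex)"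
    using local_conversion[OF y n y'] by blast
  have yn: "ons n dY y" using y n ons_mono by (auto simp: onb_iff_ons)
  show ?thesis
  proof (rule entanglement_mono[OF E R tprod_isometry[OF x yn] tprod_carrier])
    show "locc_channel dX dY dX dY' (map (\<lambda>m. kron (1\<^sub>m dX) (K m)) [0..<Suc dY])"
      using K(1,2) isometry_one by (intro locc_channel_YX)
    show "kron (1\<^sub>m dX) (K m) * tprod n dX dY x y = c m \<cdot>\<^sub>m tprod n dX dY' x y'" if "m < Suc dY" for m
    proof -
      have "kron (1\<^sub>m dX) (K m) * tprod n dX dY x y = (1 * c m) \<cdot>\<^sub>m tprod n dX dY' x y'"
        using K(1,3) that by (intro kron_tprod) (auto simp: one_mat_sum simp del: index_one_mat)
      then show ?thesis by simp
    qed
  qed (use K in auto)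
qed


subsection \<open>Measurement isometries\<close>

lemma isometry_mult:
  assumes "isometry d m V" "isometry m n G"
  shows "isometry d n (V * G)"
proof -
  have V: "V \<in> carrier_mat d m" "adj V * V = 1\<^sub>m m" and G: "G \<in> carrier_mat m n" "adj G * G = 1\<^sub>m n"
    using assms by (auto simp: isometry_def)
  have "adj (V * G) * (V * G) = adj G * (adj V * (V * G))"
    using V G adj_mult[OF V(1) G(1)] by (simp add: assoc_mult_mat[of "adj G" n m "adj V" d "V*G" n])
  also have "adj V * (V * G) = adj V * V * G"
    by (rule assoc_mult_mat[OF adj_carrier[OF V(1)] V(1) G(1), symmetric])
  finally have "adj (V * G) * (V * G) = 1\<^sub>m n" unfolding V(2) using G by simp
  then show ?thesis using V G by (simp add: isometry_def)
qed

lemma conj_mult: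
  assumes "V \<in> carrier_mat d m" "G \<in> carrier_mat m n" "R \<in> carrier_mat n n"
  shows "V * (G * R * adj G) * adj V = (V * G) * R * adj (V * G)"
proof -
  have "V * (G * R * adj G) = V * G * R * adj G"
    using assms assoc_mult_mat[of V d m "G*R" n "adj G" m] assoc_mult_mat[of V d m G n R n] by simp
  moreover have "V * G * R \<in> carrier_mat d n" using assms by simp
  ultimately show ?thesis
    using assms assoc_mult_mat[of "V * G * R" d n "adj G" m "adj V" d] adj_mult[OF assms(1,2)] by simp
qed

lemma meas_iso_A_carrier [simp]: "meas_iso_A dA dB s \<in> carrier_mat (dA*dB*dA) (dA*dB)"
  by (simp add: meas_iso_A_def)

lemma meas_iso_AB_carrier [simp]: "meas_iso_AB dA dB s t \<in> carrier_mat (dA*dB*(dA*dB)) (dA*dB)"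
  by (simp add: meas_iso_AB_def)

lemma meas_iso_A_entry:
  assumes "x < dA" "y < dB" "k < dA" "x' < dA" "y' < dB"
  shows "meas_iso_A dA dB s $$ ((x*dB+y)*dA+k, x'*dB+y') = (if y = y' then s k $ x * cnj (s k $ x') else 0)"
  using assms pair_index_less[OF pair_index_less[OF assms(1,2)] assms(3)] pair_index_less[OF assms(4,5)]
  by (simp add: meas_iso_A_def)

lemma meas_iso_AB_entry:
  assumes "x < dA" "y < dB" "k < dA" "l < dB" "x' < dA" "y' < dB"
  shows "meas_iso_AB dA dB s t $$ ((x*dB+y)*(dA*dB)+(k*dB+l), x'*dB+y') =
    s k $ x * cnj (s k $ x') * (t l $ y * cnj (t l $ y'))"
  using assms pair_index_less[OF assms(3,4)] pair_index_less[OF pair_index_less[OF assms(1,2)] pair_index_less[OF assms(3,4)]]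
    pair_index_less[OF assms(5,6)]
  unfolding meas_iso_AB_def by (simp add: pair_index_div_mod del: div_mult_self1 div_mult_self2 div_mult_self3 div_mult_self4)

definition ov :: "nat \<Rightarrow> complex vec \<Rightarrow> complex vec \<Rightarrow> complex" where
  "ov d u v = (\<Sum>i<d. cnj (u $ i) * v $ i)"

lemma sum_if_eq_mult: "finite S \<Longrightarrow> y \<in> S \<Longrightarrow> (\<Sum>v\<in>S. (if y = v then f v else 0) * g v) = f y * (g y :: complex)"
  by (subst sum.remove[of S y]) (auto intro!: sum.neutral split: if_splits)

text \<open>Column \<open>i\<close> of the product is \<Sum>k <s_k|a_i> s_k (x) b_i (x) |k>, with
  the register A' last.\<close>

lemma meas_iso_A_tprod_entry:
  assumes "x < dA" "y < dB" "k < dA" "i < n"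
  shows "(meas_iso_A dA dB s * tprod n dA dB a b) $$ ((x*dB+y)*dA+k, i) = s k $ x * ov dA (s k) (a i) * b i $ y"
proof -
  have "(meas_iso_A dA dB s * tprod n dA dB a b) $$ ((x*dB+y)*dA+k, i) =
      (\<Sum>c<dA*dB. meas_iso_A dA dB s $$ ((x*dB+y)*dA+k, c) * tprod n dA dB a b $$ (c,i))"
    using assms by (intro mult_entry[of _ "dA*dB*dA"]) (auto intro!: pair_index_less)
  also have "\<dots> = (\<Sum>u<dA. \<Sum>v<dB. (if y = v then s k $ x * cnj (s k $ u) else 0) * (a i $ u * b i $ v))"
    unfolding sum_lessThan_mult using assms by (intro sum.cong) (auto simp: tprod_entry meas_iso_A_entry)
  also have "\<dots> = (\<Sum>u<dA. s k $ x * cnj (s k $ u) * (a i $ u * b i $ y))"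
    using assms by (intro sum.cong refl) (subst sum_if_eq_mult, auto)
  finally show ?thesis by (simp add: ov_def sum_distrib_left sum_distrib_right mult_ac)
qed

lemma meas_iso_AB_tprod_entry:
  assumes "x < dA" "y < dB" "k < dA" "l < dB" "i < n"
  shows "(meas_iso_AB dA dB s t * tprod n dA dB a b) $$ ((x*dB+y)*(dA*dB)+(k*dB+l), i) =
    s k $ x * ov dA (s k) (a i) * (t l $ y * ov dB (t l) (b i))"
proof -
  have "(meas_iso_AB dA dB s t * tprod n dA dB a b) $$ ((x*dB+y)*(dA*dB)+(k*dB+l), i) =
      (\<Sum>c<dA*dB. meas_iso_AB dA dB s t $$ ((x*dB+y)*(dA*dB)+(k*dB+l), c) * tprod n dA dB a b $$ (c,i))"
    using assms by (intro mult_entry[of _ "dA*dB*(dA*dB)"]) (auto intro!: pair_index_less)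
  also have "\<dots> = (\<Sum>u<dA. \<Sum>v<dB. (s k $ x * (cnj (s k $ u) * a i $ u)) * (t l $ y * (cnj (t l $ v) * b i $ v)))"
    unfolding sum_lessThan_mult using assms by (intro sum.cong) (auto simp: tprod_entry meas_iso_AB_entry)
  also have "\<dots> = (s k $ x * ov dA (s k) (a i)) * (t l $ y * ov dB (t l) (b i))"
    by (simp add: ov_def sum_product[symmetric] sum_distrib_left)
  finally show ?thesis .
qed

text \<open>On A the product is \<Sum>k |s_k><s_k|s_k><s_k|: normalisation of each s_k removes the
  inner factor, and completeness gives the identity. The B part contributes only a Kronecker
  delta.\<close>

lemma isometry_meas_iso_A:
  assumes "onb dA s"
  shows "isometry (dA*dB*dA) (dA*dB) (meas_iso_A dA dB s)"
proof -
  let ?V = "meas_iso_A dA dB s"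
  have "adj ?V * ?V = 1\<^sub>m (dA*dB)"
  proof (rule eq_matI)
    fix i j assume "i < dim_row (1\<^sub>m (dA*dB))" "j < dim_col (1\<^sub>m (dA*dB))"
    then have ij: "i < dA*dB" "j < dA*dB" by auto
    obtain x y where i: "i = x*dB+y" "x < dA" "y < dB" using ij(1) by (rule pair_index_cases)
    obtain x' y' where j: "j = x'*dB+y'" "x' < dA" "y' < dB" using ij(2) by (rule pair_index_cases)
    have eq: "i = j \<longleftrightarrow> x = x' \<and> y = y'" using i j by (metis pair_index_div_mod)
    have "(adj ?V * ?V) $$ (i,j) = (\<Sum>p<dA*dB*dA. cnj (?V $$ (p,i)) * ?V $$ (p,j))"
      using ij mult_entry[OF adj_carrier[OF meas_iso_A_carrier] meas_iso_A_carrier] adj_entry[OF meas_iso_A_carrier] by simp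
    also have "\<dots> = (\<Sum>u<dA. \<Sum>v<dB. \<Sum>k<dA. (if y = v then s k $ x * cnj (s k $ x') * (cnj (s k $ u) * s k $ u) else 0) * (if v = y' then 1 else 0))"
      unfolding sum_lessThan_mult using i j by (intro sum.cong refl) (simp add: meas_iso_A_entry)
    also have "\<dots> = (\<Sum>u<dA. \<Sum>k<dA. \<Sum>v<dB. (if y = v then s k $ x * cnj (s k $ x') * (cnj (s k $ u) * s k $ u) else 0) * (if v = y' then 1 else 0))"
      by (rule sum.cong[OF refl], rule sum.swap)
    also have "\<dots> = (\<Sum>u<dA. \<Sum>k<dA. s k $ x * cnj (s k $ x') * (cnj (s k $ u) * s k $ u) * (if y = y' then 1 else 0))"
      using i by (intro sum.cong refl) (subst sum_if_eq_mult, auto)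
    also have "\<dots> = (\<Sum>k<dA. s k $ x * cnj (s k $ x') * (\<Sum>u<dA. cnj (s k $ u) * s k $ u) * (if y = y' then 1 else 0))"
      by (subst sum.swap) (simp add: sum_distrib_left sum_distrib_right)
    also have "\<dots> = (\<Sum>k<dA. s k $ x * cnj (s k $ x')) * (if y = y' then 1 else 0)"
      unfolding sum_distrib_right using assms by (intro sum.cong refl) (simp add: onb_def)
    also have "\<dots> = (if i = j then 1 else 0)"
      using onb_complete[OF assms i(2) j(2)] eq by auto
    finally show "(adj ?V * ?V) $$ (i,j) = 1\<^sub>m (dA*dB) $$ (i,j)" using ij by simp
  qed (auto simp: adj_def meas_iso_A_def)
  then show ?thesis by (simp add: isometry_def)
qed

lemma isometry_meas_iso_AB:
  assumes s: "onb dA s" and t: "onb dB t"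
  shows "isometry (dA*dB*(dA*dB)) (dA*dB) (meas_iso_AB dA dB s t)"
proof -
  let ?V = "meas_iso_AB dA dB s t"
  have "adj ?V * ?V = 1\<^sub>m (dA*dB)"
  proof (rule eq_matI)
    fix i j assume "i < dim_row (1\<^sub>m (dA*dB))" "j < dim_col (1\<^sub>m (dA*dB))"
    then have ij: "i < dA*dB" "j < dA*dB" by auto
    obtain x y where i: "i = x*dB+y" "x < dA" "y < dB" using ij(1) by (rule pair_index_cases)
    obtain x' y' where j: "j = x'*dB+y'" "x' < dA" "y' < dB" using ij(2) by (rule pair_index_cases)
    have eq: "i = j \<longleftrightarrow> x = x' \<and> y = y'" using i j by (metis pair_index_div_mod)
    \<comment> \<open>The contribution of one party. The entries of the two-sided isometry
      factorise, so the Gram matrix is a product of two such sums.\<close>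
    have half: "(\<Sum>u<d. \<Sum>k<d. f k $ p * cnj (f k $ q) * (cnj (f k $ u) * f k $ u)) = (if p = q then 1 else 0)"
      if f: "onb d f" and "p < d" "q < d" for d f p q
    proof -
      have "(\<Sum>u<d. \<Sum>k<d. f k $ p * cnj (f k $ q) * (cnj (f k $ u) * f k $ u)) =
          (\<Sum>k<d. f k $ p * cnj (f k $ q) * (\<Sum>u<d. cnj (f k $ u) * f k $ u))"
        by (subst sum.swap) (simp add: sum_distrib_left)
      also have "\<dots> = (\<Sum>k<d. f k $ p * cnj (f k $ q))"
        using f by (intro sum.cong refl) (simp add: onb_def)
      finally show ?thesis using onb_complete that by simp
    qed
    have "(adj ?V * ?V) $$ (i,j) = (\<Sum>p<dA*dB*(dA*dB). cnj (?V $$ (p,i)) * ?V $$ (p,j))"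
      using ij mult_entry[OF adj_carrier[OF meas_iso_AB_carrier] meas_iso_AB_carrier] adj_entry[OF meas_iso_AB_carrier] by simp
    also have "\<dots> = (\<Sum>u<dA. \<Sum>v<dB. \<Sum>k<dA. \<Sum>l<dB. (s k $ x * cnj (s k $ x') * (cnj (s k $ u) * s k $ u))
        * (t l $ y * cnj (t l $ y') * (cnj (t l $ v) * t l $ v)))"
      unfolding sum_lessThan_mult using i j by (intro sum.cong refl) (simp add: meas_iso_AB_entry)
    also have "\<dots> = (\<Sum>u<dA. \<Sum>k<dA. s k $ x * cnj (s k $ x') * (cnj (s k $ u) * s k $ u))
        * (\<Sum>v<dB. \<Sum>l<dB. t l $ y * cnj (t l $ y') * (cnj (t l $ v) * t l $ v))"
      by (simp only: sum_product)
    also have "\<dots> = (if i = j then 1 else 0)"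
      using half[OF s i(2) j(2)] half[OF t i(3) j(3)] eq by simp
    finally show "(adj ?V * ?V) $$ (i,j) = 1\<^sub>m (dA*dB) $$ (i,j)" using ij by simp
  qed (auto simp: adj_def meas_iso_AB_def)
  then show ?thesis by (simp add: isometry_def)
qed

subsection \<open>Fourier measurement\<close>

text \<open>The phases are \<open>w m k = z k ^ m\<close> with z_k = exp(2 pi i k/d). For k distinct
  from l the orthogonality sum is geometric, and its ratio is a d-th root of unity different from 1,
  so it vanishes.\<close>

lemma fourier_phases:
  assumes "0 < d"
  obtains w :: "nat \<Rightarrow> nat \<Rightarrow> complex" where "\<And>m k. w m k * cnj (w m k) = 1"
    "\<And>k l. k < d \<Longrightarrow> l < d \<Longrightarrow> (\<Sum>m<d. cnj (w m k) * w m l) = (if k = l then of_nat d else 0)"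
proof
  define z where "z k = cis (2 * pi * real k / real d)" for k
  have z1: "z k * cnj (z k) = 1" for k by (simp add: z_def cis_cnj cis_mult)
  have zd: "z k ^ d = 1" for k
  proof -
    have "z k ^ d = cis (2 * pi * real k)" using assms by (simp add: z_def DeMoivre)
    then show ?thesis by (simp add: cis_multiple_2pi)
  qed
  show "z k ^ m * cnj (z k ^ m) = 1" for m k
    using z1[of k] by (simp add: power_mult_distrib[symmetric])
  fix k l assume kl: "k < d" "l < d"
  let ?q = "cnj (z k) * z l"
  have sum: "(\<Sum>m<d. cnj (z k ^ m) * z l ^ m) = (\<Sum>m<d. ?q ^ m)" by (simp add: power_mult_distrib)
  show "(\<Sum>m<d. cnj (z k ^ m) * z l ^ m) = (if k = l then of_nat d else 0)"
  proof (cases "k = l")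
    case True
    then show ?thesis unfolding sum using z1[of k] by (simp add: mult.commute)
  next
    case False
    have "z k \<noteq> z l"
      using bij_betw_roots_unity[OF assms] kl False unfolding bij_betw_def z_def by (auto dest: inj_onD)
    have "?q \<noteq> 1"
    proof
      assume "?q = 1"
      then have "z k * (cnj (z k) * z l) = z k" by simp
      then have "z l = z k" using z1[of k] by (simp add: mult.assoc[symmetric])
      with \<open>z k \<noteq> z l\<close> show False by simp
    qed
    moreover have "?q ^ d = 1" using zd[of k] zd[of l] by (simp add: power_mult_distrib complex_cnj_power[symmetric] del: complex_cnj_power)
    ultimately show ?thesis unfolding sum using False by (simp add: geometric_sum)
  qed
qed

text \<open>The row \<open>f m\<close> is the bra \<Sum>k (w m k / sqrt d) <s_k|. All basis vectors
  s_k give each outcome with the same probability 1/d, so the measurement reveals nothing about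
  \<open>k\<close>; it leaves only a phase, which can be undone once \<open>m\<close> is known. A
  single row means that the measured system is discarded.\<close>

lemma fourier_measurement:
  assumes d: "0 < d" and s: "onb d s"
  obtains w :: "nat \<Rightarrow> nat \<Rightarrow> complex" and f where "\<And>m k. w m k * cnj (w m k) = 1"
    "\<And>m. f m \<in> carrier_mat 1 d"
    "\<And>m k. k < d \<Longrightarrow> (\<Sum>x<d. f m $$ (0,x) * s k $ x) = w m k / of_real (sqrt d)"
    "\<And>x y. x < d \<Longrightarrow> y < d \<Longrightarrow> (\<Sum>m<d. cnj (f m $$ (0,x)) * f m $$ (0,y)) = (if x = y then 1 else 0)"
proof -
  obtain w :: "nat \<Rightarrow> nat \<Rightarrow> complex" where w: "\<And>m k. w m k * cnj (w m k) = 1"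
    "\<And>k l. k < d \<Longrightarrow> l < d \<Longrightarrow> (\<Sum>m<d. cnj (w m k) * w m l) = (if k = l then of_nat d else 0)"
    using fourier_phases[OF d] by blast
  define e where "e = complex_of_real (sqrt d)"
  have e: "cnj e = e" "e * e = of_nat d" "e \<noteq> 0"
    using d by (auto simp: e_def of_real_mult[symmetric] simp del: of_real_mult)
  define f where "f m = mat 1 d (\<lambda>(_,x). \<Sum>k<d. w m k / e * cnj (s k $ x))" for m
  have "(\<Sum>x<d. f m $$ (0,x) * s k $ x) = w m k / e" if k: "k < d" for m k
  proof -
    have "(\<Sum>x<d. f m $$ (0,x) * s k $ x) = (\<Sum>x<d. \<Sum>l<d. w m l / e * (cnj (s l $ x) * s k $ x))"
      by (intro sum.cong refl) (simp add: f_def sum_distrib_right mult.assoc)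
    also have "\<dots> = (\<Sum>l<d. w m l / e * (\<Sum>x<d. cnj (s l $ x) * s k $ x))"
      by (subst sum.swap) (simp add: sum_distrib_left)
    also have "\<dots> = (\<Sum>l<d. if l = k then w m l / e else 0)"
      using s k by (intro sum.cong refl) (simp add: onb_def)
    finally show ?thesis using k by simp
  qed
  moreover have "(\<Sum>m<d. cnj (f m $$ (0,x)) * f m $$ (0,y)) = (if x = y then 1 else 0)" if xy: "x < d" "y < d" for x y
  proof -
    have "(\<Sum>m<d. cnj (f m $$ (0,x)) * f m $$ (0,y)) =
        (\<Sum>m<d. \<Sum>k<d. \<Sum>l<d. (cnj (w m k) * w m l) * (s k $ x * cnj (s l $ y) / of_nat d))"
    proof (rule sum.cong[OF refl])
      fix m
      have "cnj (f m $$ (0,x)) = (\<Sum>k<d. cnj (w m k) / e * s k $ x)" "f m $$ (0,y) = (\<Sum>k<d. w m k / e * cnj (s k $ y))"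
        using xy e by (auto simp: f_def)
      then show "cnj (f m $$ (0,x)) * f m $$ (0,y) =
          (\<Sum>k<d. \<Sum>l<d. (cnj (w m k) * w m l) * (s k $ x * cnj (s l $ y) / of_nat d))"
        by (simp only: sum_product e(2)[symmetric]) (simp add: mult_ac)
    qed
    also have "\<dots> = (\<Sum>k<d. \<Sum>l<d. (\<Sum>m<d. cnj (w m k) * w m l) * (s k $ x * cnj (s l $ y) / of_nat d))"
      unfolding sum_distrib_right by (rule sum_rotate)
    \<comment> \<open>Orthogonality of the phases removes the terms with k distinct from l, and its
      factor \<open>d\<close> cancels the two factors 1 / sqrt d.\<close>
    also have "\<dots> = (\<Sum>k<d. \<Sum>l<d. if l = k then s k $ x * cnj (s l $ y) else 0)"
      using w(2) d by (intro sum.cong refl) auto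
    also have "\<dots> = (\<Sum>k<d. s k $ x * cnj (s k $ y))" by simp
    finally show ?thesis using onb_complete[OF s xy] by simp
  qed
  moreover have "f m \<in> carrier_mat 1 d" for m by (simp add: f_def)
  ultimately show thesis using that w(1) unfolding e_def by blast
qed


text \<open>Trace preservation survives tensoring with an identity. Both orders occur: A is the
  first factor of AB, and B' is the second factor of A'B'.\<close>

lemma kraus_sum_kron_one:
  assumes f: "\<And>m. f m \<in> carrier_mat 1 d" and d: "0 < d" "0 < e"
    and ff: "\<And>x y. x < d \<Longrightarrow> y < d \<Longrightarrow> (\<Sum>m<M. cnj (f m $$ (0,x)) * f m $$ (0,y)) = (if x = y then 1 else 0)"
  shows "kraus_sum (d*e) (map (\<lambda>m. kron (f m) (1\<^sub>m e)) [0..<M]) = 1\<^sub>m (d*e)"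
    and "kraus_sum (e*d) (map (\<lambda>m. kron (1\<^sub>m e) (f m)) [0..<M]) = 1\<^sub>m (e*d)"
proof -
  have gram: "(adj (f m) * f m) \<in> carrier_mat d d" for m by (rule mult_carrier_mat[OF adj_carrier[OF f] f])
  have fc: "kron (f m) (1\<^sub>m e) \<in> carrier_mat (1*e) (d*e)" "kron (1\<^sub>m e) (f m) \<in> carrier_mat (e*1) (e*d)" for m
    by (rule kron_carrier[OF f one_carrier_mat], rule kron_carrier[OF one_carrier_mat f])
  have ent: "(adj (f m) * f m) $$ (x,y) = cnj (f m $$ (0,x)) * f m $$ (0,y)" if "x < d" "y < d" for m x y
    using mult_entry[OF adj_carrier[OF f] f that] adj_entry[OF f that(1), of 0] by simp
  show "kraus_sum (d*e) (map (\<lambda>m. kron (f m) (1\<^sub>m e)) [0..<M]) = 1\<^sub>m (d*e)"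
  proof (rule kraus_sum_eq_one[of _ _ "1*e"])
    fix i j assume ij: "i < d*e" "j < d*e"
    obtain x y where i: "i = x*e+y" "x < d" "y < e" using ij(1) by (rule pair_index_cases)
    obtain x' y' where j: "j = x'*e+y'" "x' < d" "y' < e" using ij(2) by (rule pair_index_cases)
    have "(adj (kron (f m) (1\<^sub>m e)) * kron (f m) (1\<^sub>m e)) $$ (i,j) =
        cnj (f m $$ (0,x)) * f m $$ (0,x') * (if y = y' then 1 else 0)" for m
      using i j kron_mult[OF adj_carrier[OF f] one_carrier_mat f one_carrier_mat, of m e m]
        kron_entry[OF gram one_carrier_mat, of x y e x' y' m] adj_kron[OF f one_carrier_mat, of m e] ent
      by simp
    moreover have "i = j \<longleftrightarrow> x = x' \<and> y = y'" using i j by (metis pair_index_div_mod)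
    ultimately show "(\<Sum>m<M. (adj (kron (f m) (1\<^sub>m e)) * kron (f m) (1\<^sub>m e)) $$ (i,j)) = (if i = j then 1 else 0)"
      using ff[OF i(2) j(2)] by (auto simp: sum_distrib_right[symmetric])
  qed (use fc d in auto)
  show "kraus_sum (e*d) (map (\<lambda>m. kron (1\<^sub>m e) (f m)) [0..<M]) = 1\<^sub>m (e*d)"
  proof (rule kraus_sum_eq_one[of _ _ "e*1"])
    fix i j assume ij: "i < e*d" "j < e*d"
    obtain x y where i: "i = x*d+y" "x < e" "y < d" using ij(1) by (rule pair_index_cases)
    obtain x' y' where j: "j = x'*d+y'" "x' < e" "y' < d" using ij(2) by (rule pair_index_cases)
    have "(adj (kron (1\<^sub>m e) (f m)) * kron (1\<^sub>m e) (f m)) $$ (i,j) =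
        cnj (f m $$ (0,y)) * f m $$ (0,y') * (if x = x' then 1 else 0)" for m
      using i j kron_mult[OF one_carrier_mat adj_carrier[OF f] one_carrier_mat f, of e m m]
        kron_entry[OF one_carrier_mat gram, of x e y x' y' m] adj_kron[OF one_carrier_mat f, of e m] ent
      by simp
    moreover have "i = j \<longleftrightarrow> x = x' \<and> y = y'" using i j by (metis pair_index_div_mod)
    ultimately show "(\<Sum>m<M. (adj (kron (1\<^sub>m e) (f m)) * kron (1\<^sub>m e) (f m)) $$ (i,j)) = (if i = j then 1 else 0)"
      using ff[OF i(3) j(3)] by (auto simp: sum_distrib_right[symmetric])
  qed (use fc d in auto)
qed

section \<open>Protocols that undo the measurement interaction\<close>

lemma sum_inverse_sqrt_squares:
  fixes d :: nat
  assumes "0 < d"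
  shows "(\<Sum>m<d. (1 / complex_of_real (sqrt d)) * cnj (1 / complex_of_real (sqrt d))) = 1"
  using assms by (simp add: of_real_mult[symmetric] del: of_real_mult)

text \<open>Applying \<open>f m\<close> to A turns column \<open>i\<close> into b_i (x) \<Sum>k w m
  k <s_k|a_i> |k>, up to 1 / sqrt dA. The correction \<open>U m\<close>, which maps |k> to cnj (w m
  k) s_k, cancels the phases and rebuilds a_i on A'. The first party is left with B only, hence the
  order B:A.\<close>

lemma entanglement_meas_iso_A_ge:
  assumes E: "entanglement_measure E" and R: "is_state n R" and d: "0 < dA" "0 < dB"
    and s: "onb dA s" and a: "ons n dA a" and b: "ons n dB b"
    and G_def: "G = meas_iso_A dA dB s * tprod n dA dB a b"
  shows "E dB dA (tprod n dB dA b a * R * adj (tprod n dB dA b a)) \<le> E (dA*dB) dA (G * R * adj G)"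
proof -
  obtain w f where w: "\<And>m k. w m k * cnj (w m k) = (1::complex)"
    and f: "\<And>m. f m \<in> carrier_mat 1 dA"
    and fs: "\<And>m k. k < dA \<Longrightarrow> (\<Sum>x<dA. f m $$ (0,x) * s k $ x) = w m k / of_real (sqrt dA)"
    and ff: "\<And>x y. x < dA \<Longrightarrow> y < dA \<Longrightarrow> (\<Sum>m<dA. cnj (f m $$ (0,x)) * f m $$ (0,y)) = (if x = y then 1 else 0)"
    using fourier_measurement[OF d(1) s] by blast
  \<comment> \<open>The amplitude of every outcome: each of the \<open>dA\<close> outcomes has
    probability 1/dA.\<close>
  define c where "c = 1 / complex_of_real (sqrt dA)"
  define K where "K m = kron (f m) (1\<^sub>m dB)" for m
  define U where "U m = mat dA dA (\<lambda>(x,k). cnj (w m k) * s k $ x)" for m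
  have Kc: "K m \<in> carrier_mat dB (dA*dB)" for m
    using kron_carrier[OF f one_carrier_mat, of m dB] by (simp add: K_def)
  have Uc: "U m \<in> carrier_mat dA dA" for m by (simp add: U_def)
  have Ui: "isometry dA dA (U m)" for m
  proof -
    have "adj (U m) * U m = 1\<^sub>m dA"
    proof (rule eq_matI)
      fix k l assume "k < dim_row (1\<^sub>m dA)" "l < dim_col (1\<^sub>m dA)"
      then have kl: "k < dA" "l < dA" by auto
      have "(adj (U m) * U m) $$ (k,l) = (\<Sum>x<dA. (w m k * cnj (w m l)) * (cnj (s k $ x) * s l $ x))"
        unfolding mult_entry[OF adj_carrier[OF Uc] Uc kl]
        using kl by (intro sum.cong refl) (simp add: U_def adj_def)
      also have "\<dots> = (w m k * cnj (w m l)) * (if k = l then 1 else 0)"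
        using s kl by (simp add: sum_distrib_left[symmetric] onb_def)
      also have "\<dots> = (if k = l then 1 else 0)" using w by auto
      finally show "(adj (U m) * U m) $$ (k,l) = 1\<^sub>m dA $$ (k,l)" using kl by simp
    qed (auto simp: adj_def U_def)
    then show ?thesis using Uc by (simp add: isometry_def)
  qed
  have Gi: "isometry (dA*dB*dA) n G"
    unfolding G_def by (intro isometry_mult[OF isometry_meas_iso_A[OF s]] tprod_isometry a b)
  then have Gc: "G \<in> carrier_mat (dA*dB*dA) n" by (simp add: isometry_def)
  have KU: "kron (K m) (U m) \<in> carrier_mat (dB*dA) (dA*dB*dA)" for m
    by (intro kron_carrier Kc Uc)
  have Kent: "K m $$ (y, u*dB+v) = f m $$ (0,u) * (if y = v then 1 else 0)"
    if "y < dB" "u < dA" "v < dB" for m y u v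
    using kron_entry[OF f one_carrier_mat, of 0 y dB u v m] that by (simp add: K_def)
  show ?thesis
  proof (rule entanglement_mono[where c = "\<lambda>_. c", OF E R Gi tprod_carrier])
    show "locc_channel (dA*dB) dA dB dA (map (\<lambda>m. kron (K m) (U m)) [0..<dA])"
      using Kc Ui kraus_sum_kron_one(1)[OF f d ff] unfolding K_def by (intro locc_channel_XY) auto
    show "(\<Sum>m<dA. c * cnj c) = 1"
      using sum_inverse_sqrt_squares[OF d(1)] by (simp add: c_def)
    fix m
    show "kron (K m) (U m) * G = c \<cdot>\<^sub>m tprod n dB dA b a"
    proof (rule eq_matI)
      fix p i assume "p < dim_row (c \<cdot>\<^sub>m tprod n dB dA b a)" "i < dim_col (c \<cdot>\<^sub>m tprod n dB dA b a)"
      then have p: "p < dB*dA" and i: "i < n" by (auto simp: tprod_def)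
      obtain y x where yx: "p = y*dA+x" "y < dB" "x < dA" using p by (rule pair_index_cases)
      have "(kron (K m) (U m) * G) $$ (p,i) = (\<Sum>q<dA*dB*dA. kron (K m) (U m) $$ (p,q) * G $$ (q,i))"
        by (rule mult_entry[OF KU Gc p i])
      also have "\<dots> = (\<Sum>u<dA. \<Sum>v<dB. (if y = v then 1 else 0) * (\<Sum>k<dA. f m $$ (0,u) * (cnj (w m k) * s k $ x) * (s k $ u * ov dA (s k) (a i) * b i $ v)))"
        unfolding sum_lessThan_mult sum_distrib_left
      proof (intro sum.cong refl)
        fix u v k assume "u \<in> {..<dA}" "v \<in> {..<dB}" "k \<in> {..<dA}"
        then have l: "u < dA" "v < dB" "k < dA" by auto
        have "kron (K m) (U m) $$ (p, (u*dB+v)*dA+k) = K m $$ (y, u*dB+v) * U m $$ (x,k)"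
          unfolding yx(1) using yx l by (intro kron_entry[OF Kc Uc] pair_index_less)
        then show "kron (K m) (U m) $$ (p, (u*dB+v)*dA+k) * G $$ ((u*dB+v)*dA+k, i) =
            (if y = v then 1 else 0) * (f m $$ (0,u) * (cnj (w m k) * s k $ x) * (s k $ u * ov dA (s k) (a i) * b i $ v))"
          using l yx i Kent[of y u v m] unfolding G_def
          by (simp add: meas_iso_A_tprod_entry U_def)
      qed
      also have "\<dots> = (\<Sum>u<dA. \<Sum>k<dA. f m $$ (0,u) * (cnj (w m k) * s k $ x) * (s k $ u * ov dA (s k) (a i) * b i $ y))"
        using yx by (simp add: sum_if_eq_mult)
      also have "\<dots> = (\<Sum>k<dA. (\<Sum>u<dA. f m $$ (0,u) * s k $ u) * (cnj (w m k) * s k $ x * ov dA (s k) (a i) * b i $ y))"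
        unfolding sum_distrib_right by (rule trans[OF sum.swap]) (simp add: mult_ac)
      also have "\<dots> = (\<Sum>k<dA. c * b i $ y * (s k $ x * ov dA (s k) (a i)))"
      proof (intro sum.cong refl)
        fix k assume "k \<in> {..<dA}"
        then have "(\<Sum>u<dA. f m $$ (0,u) * s k $ u) * (cnj (w m k) * s k $ x * ov dA (s k) (a i) * b i $ y) =
           (w m k * cnj (w m k)) * (c * b i $ y * (s k $ x * ov dA (s k) (a i)))"
          by (simp add: fs c_def)
        then show "(\<Sum>u<dA. f m $$ (0,u) * s k $ u) * (cnj (w m k) * s k $ x * ov dA (s k) (a i) * b i $ y) =
           c * b i $ y * (s k $ x * ov dA (s k) (a i))" using w by simp
      qed
      \<comment> \<open>The remaining sum over \<open>k\<close> is the expansion of a_i in the basis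
        \<open>s\<close>.\<close>
      also have "\<dots> = c * b i $ y * a i $ x"
        using onb_expand[OF s yx(3), of "\<lambda>j. a i $ j"] by (simp add: sum_distrib_left[symmetric] ov_def)
      finally show "(kron (K m) (U m) * G) $$ (p,i) = (c \<cdot>\<^sub>m tprod n dB dA b a) $$ (p,i)"
        using p i yx tprod_entry[of y dB x dA i n b a] by (simp add: tprod_def)
    qed (use carrier_matD[OF KU[of m]] Gc in \<open>auto simp: tprod_def\<close>)
  qed (use KU in auto)
qed

text \<open>Measuring B' in a Fourier basis leaves the phase \<open>w m l\<close> on the component
  t_l of B, and \<open>D m\<close> removes it there. The sum over \<open>l\<close> then restores b_i
  on B, so only the copying of A remains.\<close>

lemma entanglement_meas_iso_AB_ge:
  assumes E: "entanglement_measure E" and R: "is_state n R" and d: "0 < dA" "0 < dB"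
    and s: "onb dA s" and t: "onb dB t" and a: "ons n dA a" and b: "ons n dB b"
    and G_def: "G = meas_iso_AB dA dB s t * tprod n dA dB a b"
    and H_def: "H = meas_iso_A dA dB s * tprod n dA dB a b"
  shows "E (dA*dB) dA (H * R * adj H) \<le> E (dA*dB) (dA*dB) (G * R * adj G)"
proof -
  \<comment> \<open>The register B' stores \<open>l\<close> in the computational basis whatever
    \<open>t\<close> is, so the Fourier measurement is taken relative to the standard basis.\<close>
  have std: "onb dB (unit_vec dB)"
    unfolding onb_iff_ons by (rule ons_unit_vec[of dB "\<lambda>i. i"]) auto
  obtain w f where w: "\<And>m k. w m k * cnj (w m k) = (1::complex)"
    and f: "\<And>m. f m \<in> carrier_mat 1 dB"
    and fs: "\<And>m k. k < dB \<Longrightarrow> (\<Sum>x<dB. f m $$ (0,x) * unit_vec dB k $ x) = w m k / of_real (sqrt dB)"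
    and ff: "\<And>x y. x < dB \<Longrightarrow> y < dB \<Longrightarrow> (\<Sum>m<dB. cnj (f m $$ (0,x)) * f m $$ (0,y)) = (if x = y then 1 else 0)"
    using fourier_measurement[OF d(2) std] by blast
  define c where "c = 1 / complex_of_real (sqrt dB)"
  have fw: "f m $$ (0,k) = w m k * c" if k: "k < dB" for m k
  proof -
    have "(\<Sum>x<dB. f m $$ (0,x) * unit_vec dB k $ x) = (\<Sum>x<dB. if x = k then f m $$ (0,x) else 0)"
      using k by (intro sum.cong refl) (simp add: unit_vec_def)
    then show ?thesis using fs[OF k, of m] k by (simp add: c_def)
  qed
  define L where "L m = kron (1\<^sub>m dA) (f m)" for m
  \<comment> \<open>The unitary diagonal in the basis \<open>t\<close> with eigenvalues cnj (w m l).
    Here the vectors t_l are still present on B, so only phases need correcting.\<close>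
  define D where "D m = mat dB dB (\<lambda>(y,v). \<Sum>l<dB. cnj (w m l) * t l $ y * cnj (t l $ v))" for m
  define W where "W m = kron (1\<^sub>m dA) (D m)" for m
  have Lc: "L m \<in> carrier_mat dA (dA*dB)" for m
    using kron_carrier[OF one_carrier_mat f, of dA m] by (simp add: L_def)
  have Dc: "D m \<in> carrier_mat dB dB" for m by (simp add: D_def)
  have Wc: "W m \<in> carrier_mat (dA*dB) (dA*dB)" for m by (simp add: W_def Dc)
  have Dt: "(\<Sum>v<dB. D m $$ (y,v) * t l $ v) = cnj (w m l) * t l $ y" if yl: "y < dB" "l < dB" for m y l
  proof -
    have "(\<Sum>v<dB. D m $$ (y,v) * t l $ v) = (\<Sum>v<dB. \<Sum>k<dB. (cnj (w m k) * t k $ y) * (cnj (t k $ v) * t l $ v))"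
      using yl by (intro sum.cong refl) (simp add: D_def sum_distrib_right mult.assoc)
    also have "\<dots> = (\<Sum>k<dB. (cnj (w m k) * t k $ y) * (\<Sum>v<dB. cnj (t k $ v) * t l $ v))"
      by (subst sum.swap) (simp add: sum_distrib_left)
    also have "\<dots> = (\<Sum>k<dB. if k = l then cnj (w m k) * t k $ y else 0)"
      using t yl by (intro sum.cong refl) (simp add: onb_def)
    finally show ?thesis using yl by simp
  qed
  have "adj (D m) * D m = 1\<^sub>m dB" for m
  proof (rule eq_matI)
    fix p q assume "p < dim_row (1\<^sub>m dB)" "q < dim_col (1\<^sub>m dB)"
    then have pq: "p < dB" "q < dB" by auto
    have cD: "cnj (D m $$ (v,p)) = (\<Sum>l<dB. w m l * t l $ p * cnj (t l $ v))" if "v < dB" for v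
      using that pq by (simp add: D_def mult_ac)
    have Dstar: "(\<Sum>v<dB. cnj (t l $ v) * D m $$ (v,q)) = cnj (w m l) * cnj (t l $ q)" if l: "l < dB" for l
    proof -
      have "(\<Sum>v<dB. cnj (t l $ v) * D m $$ (v,q)) = (\<Sum>v<dB. \<Sum>k<dB. (cnj (w m k) * cnj (t k $ q)) * (cnj (t l $ v) * t k $ v))"
        using pq by (intro sum.cong refl) (simp add: D_def sum_distrib_left mult_ac)
      also have "\<dots> = (\<Sum>k<dB. (cnj (w m k) * cnj (t k $ q)) * (\<Sum>v<dB. cnj (t l $ v) * t k $ v))"
        by (subst sum.swap) (simp add: sum_distrib_left)
      also have "\<dots> = (\<Sum>k<dB. if k = l then cnj (w m k) * cnj (t k $ q) else 0)"
        using t l by (intro sum.cong refl) (simp add: onb_def)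
      finally show ?thesis using l by simp
    qed
    have "(adj (D m) * D m) $$ (p,q) = (\<Sum>v<dB. \<Sum>l<dB. (w m l * t l $ p) * (cnj (t l $ v) * D m $$ (v,q)))"
      unfolding mult_entry[OF adj_carrier[OF Dc] Dc pq]
      using pq by (intro sum.cong refl) (simp add: adj_entry[OF Dc] cD sum_distrib_right mult.assoc)
    also have "\<dots> = (\<Sum>l<dB. (w m l * t l $ p) * (\<Sum>v<dB. cnj (t l $ v) * D m $$ (v,q)))"
      by (subst sum.swap) (simp add: sum_distrib_left)
    also have "\<dots> = (\<Sum>l<dB. (w m l * cnj (w m l)) * (t l $ p * cnj (t l $ q)))"
      by (intro sum.cong refl) (simp add: Dstar)
    also have "\<dots> = (if p = q then 1 else 0)" using onb_complete[OF t pq] w by simp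
    finally show "(adj (D m) * D m) $$ (p,q) = 1\<^sub>m dB $$ (p,q)" using pq by simp
  qed (auto simp: adj_def D_def)
  then have Wi: "isometry (dA*dB) (dA*dB) (W m)" for m
    using kron_mult[OF one_carrier_mat adj_carrier[OF Dc] one_carrier_mat Dc, of dA m m]
      adj_kron[OF one_carrier_mat Dc, of dA m] Wc kron_one[of dA dB]
    by (simp add: isometry_def W_def)
  have Gi: "isometry (dA*dB*(dA*dB)) n G"
    unfolding G_def by (intro isometry_mult[OF isometry_meas_iso_AB[OF s t]] tprod_isometry a b)
  then have Gc: "G \<in> carrier_mat (dA*dB*(dA*dB)) n" by (simp add: isometry_def)
  have Hc: "H \<in> carrier_mat (dA*dB*dA) n" unfolding H_def by (rule mult_carrier_mat[OF meas_iso_A_carrier tprod_carrier])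
  have WL: "kron (W m) (L m) \<in> carrier_mat (dA*dB*dA) (dA*dB*(dA*dB))" for m
    by (intro kron_carrier Wc Lc)
  have Lent: "L m $$ (k, k'*dB+l) = (if k = k' then 1 else 0) * f m $$ (0,l)"
    if "k < dA" "k' < dA" "l < dB" for m k k' l
    using kron_entry[OF one_carrier_mat f, of k dA 0 k' l m] that by (simp add: L_def)
  have Went: "W m $$ (x*dB+y, u*dB+v) = (if x = u then 1 else 0) * D m $$ (y,v)"
    if "x < dA" "y < dB" "u < dA" "v < dB" for m x y u v
    using kron_entry[OF one_carrier_mat Dc, of x dA y u v m] that by (simp add: W_def)
  show ?thesis
  proof (rule entanglement_mono[where c = "\<lambda>_. c", OF E R Gi Hc])
    show "locc_channel (dA*dB) (dA*dB) (dA*dB) dA (map (\<lambda>m. kron (W m) (L m)) [0..<dB])"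
      using Lc Wi kraus_sum_kron_one(2)[OF f d(2,1) ff] unfolding L_def by (intro locc_channel_YX) auto
    show "(\<Sum>m<dB. c * cnj c) = 1"
      using sum_inverse_sqrt_squares[OF d(2)] by (simp add: c_def)
    fix m
    show "kron (W m) (L m) * G = c \<cdot>\<^sub>m H"
    proof (rule eq_matI)
      fix p i assume "p < dim_row (c \<cdot>\<^sub>m H)" "i < dim_col (c \<cdot>\<^sub>m H)"
      then have p: "p < dA*dB*dA" and i: "i < n" using Hc by auto
      obtain xy k where k: "p = xy*dA+k" "xy < dA*dB" "k < dA" using p by (rule pair_index_cases)
      obtain x y where xy: "xy = x*dB+y" "x < dA" "y < dB" using k(2) by (rule pair_index_cases)
      have "(kron (W m) (L m) * G) $$ (p,i) = (\<Sum>q<dA*dB*(dA*dB). kron (W m) (L m) $$ (p,q) * G $$ (q,i))"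
        by (rule mult_entry[OF WL Gc p i])
      also have "\<dots> = (\<Sum>u<dA. \<Sum>v<dB. \<Sum>k'<dA. \<Sum>l<dB. (if x = u then 1 else 0) * ((if k = k' then 1 else 0) *
          (D m $$ (y,v) * f m $$ (0,l) * (s k' $ u * ov dA (s k') (a i) * (t l $ v * ov dB (t l) (b i))))))"
        unfolding sum_lessThan_mult
      proof (intro sum.cong refl)
        fix u v k' l assume "u \<in> {..<dA}" "v \<in> {..<dB}" "k' \<in> {..<dA}" "l \<in> {..<dB}"
        then have l: "u < dA" "v < dB" "k' < dA" "l < dB" by auto
        have "kron (W m) (L m) $$ (p, (u*dB+v)*(dA*dB)+(k'*dB+l)) = W m $$ (xy, u*dB+v) * L m $$ (k, k'*dB+l)"
          unfolding k(1) using k l by (intro kron_entry[OF Wc Lc] pair_index_less)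
        then show "kron (W m) (L m) $$ (p, (u*dB+v)*(dA*dB)+(k'*dB+l)) * G $$ ((u*dB+v)*(dA*dB)+(k'*dB+l), i) =
          (if x = u then 1 else 0) * ((if k = k' then 1 else 0) *
          (D m $$ (y,v) * f m $$ (0,l) * (s k' $ u * ov dA (s k') (a i) * (t l $ v * ov dB (t l) (b i)))))"
          unfolding G_def meas_iso_AB_tprod_entry[OF l i]
          using Lent[OF k(3) l(3,4), of m] Went[OF xy(2,3) l(1,2), of m] xy(1) by simp
      qed
      also have "\<dots> = (\<Sum>v<dB. \<Sum>l<dB. D m $$ (y,v) * f m $$ (0,l) * (s k $ x * ov dA (s k) (a i) * (t l $ v * ov dB (t l) (b i))))"
        using k xy by (simp only: sum_distrib_left[symmetric]) (simp add: sum_if_eq_mult)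
      also have "\<dots> = (\<Sum>l<dB. (\<Sum>v<dB. D m $$ (y,v) * t l $ v) * (f m $$ (0,l) * (s k $ x * ov dA (s k) (a i) * ov dB (t l) (b i))))"
        unfolding sum_distrib_right by (rule trans[OF sum.swap]) (simp add: mult_ac)
      also have "\<dots> = (\<Sum>l<dB. (w m l * cnj (w m l)) * (c * (s k $ x * ov dA (s k) (a i)) * (t l $ y * ov dB (t l) (b i))))"
        using xy by (intro sum.cong refl) (simp add: Dt fw)
      also have "\<dots> = c * (s k $ x * ov dA (s k) (a i)) * b i $ y"
        using onb_expand[OF t xy(3), of "\<lambda>j. b i $ j"] w by (simp add: sum_distrib_left[symmetric] ov_def)
      finally have WLG: "(kron (W m) (L m) * G) $$ (p,i) = c * (s k $ x * ov dA (s k) (a i)) * b i $ y" .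
      show "(kron (W m) (L m) * G) $$ (p,i) = (c \<cdot>\<^sub>m H) $$ (p,i)"
      proof -
        have "H $$ (p,i) = s k $ x * ov dA (s k) (a i) * b i $ y"
          unfolding H_def k(1) xy(1) by (rule meas_iso_A_tprod_entry[OF xy(2,3) k(3) i])
        then show ?thesis using p i Hc WLG by simp
      qed
    qed (use WL Gc Hc in auto)
  qed (use WL in auto)
qed

section \<open>Lower bound for all bases, attained at \<open>a\<close> and \<open>b\<close>\<close>

theorem theorem15:
  fixes E :: "nat \<Rightarrow> nat \<Rightarrow> complex mat \<Rightarrow> real"
    and dA dB :: nat
    and a b :: "nat \<Rightarrow> complex vec"
    and r :: "nat \<Rightarrow> nat \<Rightarrow> complex"
  assumes "0 < dA" and "0 < dB"
    and "onb dA a" and "onb dB b"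
    and "is_state (dA*dB) (max_corr dA dB a b r)"
    and "entanglement_measure E"
  shows "Q_AB E dA dB (max_corr dA dB a b r) = Q_A E dA dB (max_corr dA dB a b r)
       \<and> Q_A E dA dB (max_corr dA dB a b r) = E dA dB (max_corr dA dB a b r)"
proof -
  define n where "n = min dA dB"
  define R where "R = mat n n (\<lambda>(i,j). r i j)"
  define T where "T = tprod n dA dB a b"
  let ?\<rho> = "max_corr dA dB a b r"
  note E = \<open>entanglement_measure E\<close>
  have n: "0 < n" "n \<le> dA" "n \<le> dB" using assms by (auto simp: n_def)
  have a: "ons n dA a" and b: "ons n dB b"
    using assms n ons_mono unfolding onb_iff_ons by blast+
  have \<rho>: "?\<rho> = T * R * adj T" unfolding T_def R_def by (rule max_corr_eq[OF n_def])
  have Rc: "R \<in> carrier_mat n n" by (simp add: R_def)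
  have R: "is_state n R"
    using is_state_conjD[OF tprod_isometry[OF a b] Rc] assms(5) \<rho> T_def by simp
  have Tc: "T \<in> carrier_mat (dA*dB) n" by (simp add: T_def)
  have conjA: "meas_iso_A dA dB s * ?\<rho> * adj (meas_iso_A dA dB s) =
      (meas_iso_A dA dB s * T) * R * adj (meas_iso_A dA dB s * T)" for s
    unfolding \<rho> by (rule conj_mult[OF meas_iso_A_carrier Tc Rc])
  have conjAB: "meas_iso_AB dA dB s t * ?\<rho> * adj (meas_iso_AB dA dB s t) =
      (meas_iso_AB dA dB s t * T) * R * adj (meas_iso_AB dA dB s t * T)" for s t
    unfolding \<rho> by (rule conj_mult[OF meas_iso_AB_carrier Tc Rc])
  let ?EA = "\<lambda>s. E (dA*dB) dA (meas_iso_A dA dB s * ?\<rho> * adj (meas_iso_A dA dB s))"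
  let ?EAB = "\<lambda>s t. E (dA*dB) (dA*dB) (meas_iso_AB dA dB s t * ?\<rho> * adj (meas_iso_AB dA dB s t))"

  \<comment> \<open>The chain runs backwards through the protocol: the measured state yields b_i (x)
    a_i on B:A, the first party replaces b_i by a_i, and then the second replaces a_i by b_i. The
    intermediate state a_i (x) a_i lives on two copies of A.\<close>
  have lowA: "E dA dB ?\<rho> \<le> ?EA s" if s: "onb dA s" for s
  proof -
    have "E dA dB (tprod n dA dB a b * R * adj (tprod n dA dB a b))
        \<le> E dA dA (tprod n dA dA a a * R * adj (tprod n dA dA a a))"
      by (rule convert_Y[OF E R n(1,2) assms(3) b a])
    also have "\<dots> \<le> E dB dA (tprod n dB dA b a * R * adj (tprod n dB dA b a))"
      by (rule convert_X[OF E R n(1,3) assms(4) a a])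
    also have "\<dots> \<le> ?EA s"
      unfolding conjA by (rule entanglement_meas_iso_A_ge[OF E R assms(1,2) s a b]) (simp add: T_def)
    finally show ?thesis by (simp add: \<rho> T_def)
  qed
  have lowAB: "E dA dB ?\<rho> \<le> ?EAB s t" if s: "onb dA s" and t: "onb dB t" for s t
  proof -
    have "?EA s \<le> ?EAB s t"
      unfolding conjA conjAB
      by (rule entanglement_meas_iso_AB_ge[OF E R assms(1,2) s t a b]) (simp_all add: T_def)
    then show ?thesis using lowA[OF s] by simp
  qed

  define ab where "ab i = vec (dA*dB) (\<lambda>p. a i $ (p div dB) * b i $ (p mod dB))" for i
  have abent: "ab i $ (x*dB+y) = a i $ x * b i $ y" if "x < dA" "y < dB" for i x y
    using that pair_index_less[OF that] by (simp add: ab_def)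
  have ab: "ons n (dA*dB) ab"
    unfolding ons_def
  proof (intro conjI allI impI)
    fix k l assume kl: "k < n" "l < n"
    have "(\<Sum>i<dA*dB. cnj (ab k $ i) * ab l $ i) = (\<Sum>x<dA. \<Sum>y<dB. (cnj (a k $ x) * a l $ x) * (cnj (b k $ y) * b l $ y))"
      unfolding sum_lessThan_mult by (intro sum.cong refl) (simp add: abent)
    then show "(\<Sum>i<dA*dB. cnj (ab k $ i) * ab l $ i) = (if k = l then 1 else 0)"
      using kl by (simp add: sum_product[symmetric] ons_inner[OF a] ons_inner[OF b])
  qed (simp add: ab_def)
  have ovA: "ov dA (a k) (a i) = (if k = i then 1 else 0)" if "k < dA" "i < dA" for k i
    using assms(3) that by (simp add: ov_def onb_def)
  have ovB: "ov dB (b k) (b i) = (if k = i then 1 else 0)" if "k < dB" "i < dB" for k i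
    using assms(4) that by (simp add: ov_def onb_def)
  \<comment> \<open>From a_i (x) b_i, the first party prepares a_i (x) b_i entirely on its side,
    starting from a_i; afterwards the second replaces its b_i by y_i. Both upper bounds are
    instances, with y_i the content of the register.\<close>
  have copy: "E (dA*dB) d (tprod n (dA*dB) d ab y * R * adj (tprod n (dA*dB) d ab y)) \<le> E dA dB ?\<rho>"
    if y: "ons n d y" for d y
  proof -
    have "E (dA*dB) d (tprod n (dA*dB) d ab y * R * adj (tprod n (dA*dB) d ab y))
        \<le> E (dA*dB) dB (tprod n (dA*dB) dB ab b * R * adj (tprod n (dA*dB) dB ab b))"
      by (rule convert_Y[OF E R n(1,3) assms(4) y ab])
    also have "\<dots> \<le> E dA dB ?\<rho>"
      unfolding \<rho> T_def by (rule convert_X[OF E R n(1,2) assms(3) ab b])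
    finally show ?thesis .
  qed

  have upA: "?EA a \<le> E dA dB ?\<rho>"
  proof -
    have y: "ons n dA (\<lambda>i. unit_vec dA i)" using n by (intro ons_unit_vec) auto
    \<comment> \<open>With s = a the overlaps <a_k|a_i> are Kronecker deltas, so the register holds
      exactly |i>.\<close>
    have "meas_iso_A dA dB a * T = tprod n (dA*dB) dA ab (\<lambda>i. unit_vec dA i)"
    proof (rule eq_matI)
      fix p i assume "p < dim_row (tprod n (dA*dB) dA ab (\<lambda>i. unit_vec dA i))" "i < dim_col (tprod n (dA*dB) dA ab (\<lambda>i. unit_vec dA i))"
      then have p: "p < dA*dB*dA" and i: "i < n" by (auto simp: tprod_def)
      obtain xy k where k: "p = xy*dA+k" "xy < dA*dB" "k < dA" using p by (rule pair_index_cases)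
      obtain x y where xy: "xy = x*dB+y" "x < dA" "y < dB" using k(2) by (rule pair_index_cases)
      show "(meas_iso_A dA dB a * T) $$ (p,i) = tprod n (dA*dB) dA ab (\<lambda>i. unit_vec dA i) $$ (p,i)"
        using k(3) i n(2) abent[OF xy(2,3), of i] meas_iso_A_tprod_entry[OF xy(2,3) k(3) i, of a a b] tprod_entry[OF k(2,3) i, of ab "\<lambda>i. unit_vec dA i"]
        unfolding k(1) xy(1) T_def by (auto simp: ovA)
    qed (auto simp: T_def tprod_def meas_iso_A_def)
    then show ?thesis unfolding conjA using copy[OF y] by simp
  qed
  have upAB: "?EAB a b \<le> E dA dB ?\<rho>"
  proof -
    \<comment> \<open>The index \<open>i*dB+i\<close> is the register state |i>|i> of A'B'. It
      equals \<open>i * Suc dB\<close>, which is injective in \<open>i\<close>.\<close>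
    let ?y = "\<lambda>i. unit_vec (dA*dB) (i*dB+i)"
    have y: "ons n (dA*dB) ?y"
    proof (rule ons_unit_vec)
      show "inj_on (\<lambda>i. i*dB+i) {..<n}" by (rule inj_onI) (metis mult_Suc_right mult_cancel2 add.commute nat.distinct(1))
    qed (use n in \<open>auto intro!: pair_index_less\<close>)
    have "meas_iso_AB dA dB a b * T = tprod n (dA*dB) (dA*dB) ab ?y"
    proof (rule eq_matI)
      fix p i assume "p < dim_row (tprod n (dA*dB) (dA*dB) ab ?y)" "i < dim_col (tprod n (dA*dB) (dA*dB) ab ?y)"
      then have p: "p < dA*dB*(dA*dB)" and i: "i < n" by (auto simp: tprod_def)
      obtain xy kl where p': "p = xy*(dA*dB)+kl" "xy < dA*dB" "kl < dA*dB" using p by (rule pair_index_cases)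
      obtain x y where xy: "xy = x*dB+y" "x < dA" "y < dB" using p'(2) by (rule pair_index_cases)
      obtain k l where kl: "kl = k*dB+l" "k < dA" "l < dB" using p'(3) by (rule pair_index_cases)
      have i': "i < dA" "i < dB" using i n by auto
      have eq: "kl = i*dB+i \<longleftrightarrow> k = i \<and> l = i" using kl i' by (metis pair_index_div_mod)
      have yi: "?y i $ kl = (if k = i \<and> l = i then 1 else 0)"
        using p'(3) eq pair_index_less[OF i'] by (simp add: unit_vec_def)
      have "(meas_iso_AB dA dB a b * T) $$ (p,i) = a k $ x * ov dA (a k) (a i) * (b l $ y * ov dB (b l) (b i))"
        unfolding p'(1) xy(1) kl(1) T_def by (rule meas_iso_AB_tprod_entry[OF xy(2,3) kl(2,3) i])
      also have "\<dots> = ab i $ xy * ?y i $ kl"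
        unfolding yi xy(1) abent[OF xy(2,3)] ovA[OF kl(2) i'(1)] ovB[OF kl(3) i'(2)] by simp
      also have "\<dots> = tprod n (dA*dB) (dA*dB) ab ?y $$ (p,i)"
        unfolding p'(1) by (rule tprod_entry[OF p'(2,3) i, symmetric])
      finally show "(meas_iso_AB dA dB a b * T) $$ (p,i) = tprod n (dA*dB) (dA*dB) ab ?y $$ (p,i)" .
    qed (auto simp: T_def tprod_def meas_iso_AB_def)
    then show ?thesis unfolding conjAB using copy[OF y] by simp
  qed

  \<comment> \<open>The infimum is a minimum: the value is a lower bound over all bases and is
    attained at \<open>a\<close>. The same argument with \<open>a\<close> and \<open>b\<close>
    settles \<open>Q_AB\<close>.\<close>
  have "Q_A E dA dB ?\<rho> = E dA dB ?\<rho>"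
    unfolding Q_A_def
  proof (rule cInf_eq_minimum)
    show "E dA dB ?\<rho> \<in> {?EA s | s. onb dA s}"
      using upA lowA[OF assms(3)] assms(3) by (force intro: antisym)
  qed (use lowA in auto)
  moreover have "Q_AB E dA dB ?\<rho> = E dA dB ?\<rho>"
    unfolding Q_AB_def
  proof (rule cInf_eq_minimum)
    show "E dA dB ?\<rho> \<in> {?EAB s t | s t. onb dA s \<and> onb dB t}"
      using upAB lowAB[OF assms(3,4)] assms(3,4) by (force intro: antisym)
  qed (use lowAB in auto)
  ultimately show ?thesis by simp
qed

end
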